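(* Assume that $\mathrm{zer}(G)\neq\emptyset$ and that $G=\frac1n\sum_{i=1}^nG_i$ satisfies, for some $L\in(0,+\infty)$ and all $x,y\in\mathbb{R}^p$, $$\frac1n\sum_{i=1}^n\langle G_ix-G_iy,x-y\rangle\ \ge\ \frac1L\Big[\frac1n\sum_{i=1}^n\|G_ix-G_iy\|^2\Big].$$ Let $\{x^k\}$ be generated by (VFKM) with the loopless SVRG estimator with mini-batch size $b$ and probability $\mathbf{p}\in(0,1)$ such that $1\le b\mathbf{p}^2\le32$, and with $$\theta_k:=\frac{k}{k+5},\quad\gamma_k:=\frac{k}{k+3},\quad\eta_k:=\frac{2\beta(k+3)}{k+5},\quad\beta:=\frac{b\mathbf{p}^2}{2L(b\mathbf{p}^2+64)}.$$ Then $\beta\in\big[\frac1{130L},\frac1{6L}\big]$. Moreover, for any $x^\star\in\mathrm{zer}(G)$ and all $k\ge0$, $$\mathbb{E}[\|x^{k+1}-x^k\|^2]\le\frac{C_2\|x^0-x^\star\|^2}{(k+5)^2},\qquad\lim_{k\to\infty}k^2\,\mathbb{E}[\|x^{k+1}-x^k\|^2]=0,$$ $$\mathbb{E}[\|Gx^k\|^2]\le\frac{C_3\|x^0-x^\star\|^2}{\beta^2(k+2)(k+5)},\qquad\lim_{k\to\infty}k^2\,\mathbb{E}[\|Gx^k\|^2]=0,$$ where $C_2\le2360$ and $C_3\le3353$ are the explicit constants given in the context. For a given $\epsilon>0$, if $\mathbf{p}=\mathcal{O}(n^{-1/3})$ and $b=\mathcal{O}(n^{2/3})$ (subject to $1\le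 b\mathbf{p}^2\le32$), then (VFKM) requires, in expectation, $\mathcal{O}\big(n+\frac{n^{2/3}L\mathcal{R}_0}{\epsilon}\big)$ evaluations of $G_i$ to achieve $\mathbb{E}[\|Gx^k\|^2]\le\epsilon^2$, where $\mathcal{R}_0:=\|x^0-x^\star\|$.
   Context: Setting. $n,p\ge1$ are integers, $[n]=\{1,\dots,n\}$, $G_i:\mathbb{R}^p\to\mathbb{R}^p$ are single-valued mappings, $Gx:=\frac1n\sum_{i=1}^nG_ix$, $\mathrm{zer}(G):=\{x: Gx=0\}$. Method (VFKM). Given (deterministic) $x^0\in\mathbb{R}^p$, set $x^{-1}:=x^0$. At each $k\ge0$ construct an estimator $\widetilde S^k$ of $S^k:=Gx^k-\gamma_kGx^{k-1}$ (with $\widetilde S^0:=S^0$), and update $x^{k+1}:=x^k+\theta_k(x^k-x^{k-1})-\eta_k\widetilde S^k$. Loopless SVRG estimator. Set $w^0:=x^0$. For $k\ge1$: $w^k:=x^{k-1}$ with probability $\mathbf{p}$ and $w^k:=w^{k-1}$ with probability $1-\mathbf{p}$; draw an i.i.d. (uniform, with replacement) mini-batch $\mathcal{B}_k\subseteq[n]$ of fixed size $b$, where the Bernoulli choice and $\mathcal{B}_k$ are fresh (independent of the past and of each other); with $G_{\mathcal{B}_k}x:=\frac1b\sum_{i\in\mathcal{B}_k}G_ix$, $$\widetilde S^k:=(1-\gamma_k)(Gw^k-G_{\mathcal{B}_k}w^k)+G_{\mathcal{B}_k}x^k-\gamma_kG_{\mathcal{B}_k}x^{k-1}.$$ Constants: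 $\psi:=\frac{64}{64+b\mathbf{p}^2}$, $C_0:=3(10+24L^2\beta^2)$, $C_1:=\frac{72L^2\beta^2}{5}+(\frac23+\psi)C_0$, $C_2:=36L^2\beta^2+(\frac{50}{3}+\psi)C_0+\frac{100C_1}{3}$, $C_3:=\frac{25(C_1+C_2)}{18}$. Oracle complexity counts evaluations of the individual mappings $G_i$ at a point: a full evaluation $Gw$ costs $n$ and is needed only when the snapshot $w^k$ changes; a mini-batch evaluation costs $b$. Constants hidden in $\mathcal{O}$ do not depend on $n,L,\mathcal{R}_0,\epsilon$. *)

theory Defs
  imports "HOL-Probability.Probability"
begin

definition finite_avg :: "nat \<Rightarrow> (nat \<Rightarrow> real^'p \<Rightarrow> real^'p) \<Rightarrow> real^'p \<Rightarrow> real^'p" where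
  "finite_avg n G x = (1 / real n) *\<^sub>R (\<Sum>i=1..n. G i x)"

definition zer :: "(real^'p \<Rightarrow> real^'p) \<Rightarrow> (real^'p) set" where
  "zer F = {x. F x = 0}"

definition avg_cocoercive :: "nat \<Rightarrow> (nat \<Rightarrow> real^'p \<Rightarrow> real^'p) \<Rightarrow> real \<Rightarrow> bool" where
  "avg_cocoercive n G L \<longleftrightarrow>
     (\<forall>x y. (1 / real n) * (\<Sum>i=1..n. (G i x - G i y) \<bullet> (x - y))
            \<ge> (1 / L) * ((1 / real n) * (\<Sum>i=1..n. (norm (G i x - G i y))\<^sup>2)))"

text \<open>A mini-batch drawn with replacement is the list of its \<open>b\<close> sampled indices, repetitions
  included.\<close>

definition batch_avg :: "nat \<Rightarrow> (nat \<Rightarrow> real^'p \<Rightarrow> real^'p) \<Rightarrow> nat list \<Rightarrow> real^'p \<Rightarrow> real^'p" where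
  "batch_avg b G B x = (1 / real b) *\<^sub>R (\<Sum>i\<leftarrow>B. G i x)"

definition theta :: "nat \<Rightarrow> real" where
  "theta k = real k / (real k + 5)"

definition gam :: "nat \<Rightarrow> real" where
  "gam k = real k / (real k + 3)"

definition eta :: "real \<Rightarrow> nat \<Rightarrow> real" where
  "eta \<beta> k = 2 * \<beta> * (real k + 3) / (real k + 5)"

definition beta :: "real \<Rightarrow> nat \<Rightarrow> real \<Rightarrow> real" where
  "beta L b q = real b * q\<^sup>2 / (2 * L * (real b * q\<^sup>2 + 64))"

definition psi :: "nat \<Rightarrow> real \<Rightarrow> real" where
  "psi b q = 64 / (64 + real b * q\<^sup>2)"

definition C0 :: "real \<Rightarrow> nat \<Rightarrow> real \<Rightarrow> real" where
  "C0 L b q = 3 * (10 + 24 * L\<^sup>2 * (beta L b q)\<^sup>2)"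

definition C1 :: "real \<Rightarrow> nat \<Rightarrow> real \<Rightarrow> real" where
  "C1 L b q = 72 * L\<^sup>2 * (beta L b q)\<^sup>2 / 5 + (2/3 + psi b q) * C0 L b q"

definition C2 :: "real \<Rightarrow> nat \<Rightarrow> real \<Rightarrow> real" where
  "C2 L b q = 36 * L\<^sup>2 * (beta L b q)\<^sup>2 + (50/3 + psi b q) * C0 L b q + 100 * C1 L b q / 3"

definition C3 :: "real \<Rightarrow> nat \<Rightarrow> real \<Rightarrow> real" where
  "C3 L b q = 25 * (C1 L b q + C2 L b q) / 18"

text \<open>
  The fast Krasnoselskii-Mann method with the loopless SVRG estimator. \<open>Z k\<close> is the Bernoulli
  choice and \<open>B k\<close> the mini-batch of iteration \<open>k \<ge> 1\<close>. The product law of the pair \<open>(Z k, B k)\<close>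
  makes the two independent of each other, and independence of the pairs over \<open>k\<close> makes them
  independent of the past, because the iterates up to \<open>x k\<close> are determined by the earlier pairs.
  The convention that the iterate with index \<open>-1\<close> equals \<open>x 0\<close> is built into truncated
  subtraction: \<open>x (k - 1)\<close> is \<open>x 0\<close> for \<open>k = 0\<close>.
\<close>

locale vfkm_svrg = prob_space M
  for M :: "'w measure" +
  fixes n :: nat
    and G :: "nat \<Rightarrow> real^'p \<Rightarrow> real^'p"
    and L :: real
    and b :: nat
    and q :: real
    and x0 :: "real^'p"
    and Z :: "nat \<Rightarrow> 'w \<Rightarrow> bool"
    and B :: "nat \<Rightarrow> 'w \<Rightarrow> nat list"
    and w S x :: "nat \<Rightarrow> 'w \<Rightarrow> real^'p"
  assumes n_pos: "n \<ge> 1"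
    and L_pos: "L > 0"
    and zer_nonempty: "zer (finite_avg n G) \<noteq> {}"
    and cocoercive: "avg_cocoercive n G L"
    and q_range: "0 < q" "q < 1"
    and bq_range: "1 \<le> real b * q\<^sup>2" "real b * q\<^sup>2 \<le> 32"
    and draws_indep: "indep_vars (\<lambda>_. count_space UNIV) (\<lambda>k \<omega>. (Z k \<omega>, B k \<omega>)) {1..}"
    and draws_distr: "\<And>k. k \<ge> 1 \<Longrightarrow>
          distr M (count_space UNIV) (\<lambda>\<omega>. (Z k \<omega>, B k \<omega>))
          = measure_pmf (pair_pmf (bernoulli_pmf q) (replicate_pmf b (pmf_of_set {1..n})))"
    and snapshot_0: "\<And>\<omega>. \<omega> \<in> space M \<Longrightarrow> w 0 \<omega> = x0"
    and snapshot: "\<And>k \<omega>. k \<ge> 1 \<Longrightarrow> \<omega> \<in> space M \<Longrightarrow>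
          w k \<omega> = (if Z k \<omega> then x (k - 1) \<omega> else w (k - 1) \<omega>)"
    and estimator_0: "\<And>\<omega>. \<omega> \<in> space M \<Longrightarrow>
          S 0 \<omega> = finite_avg n G (x 0 \<omega>) - gam 0 *\<^sub>R finite_avg n G (x (0 - 1) \<omega>)"
    and estimator: "\<And>k \<omega>. k \<ge> 1 \<Longrightarrow> \<omega> \<in> space M \<Longrightarrow>
          S k \<omega> = (1 - gam k) *\<^sub>R (finite_avg n G (w k \<omega>) - batch_avg b G (B k \<omega>) (w k \<omega>))
                  + batch_avg b G (B k \<omega>) (x k \<omega>)
                  - gam k *\<^sub>R batch_avg b G (B k \<omega>) (x (k - 1) \<omega>)"
    and iterate_0: "\<And>\<omega>. \<omega> \<in> space M \<Longrightarrow> x 0 \<omega> = x0"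
    and iterate: "\<And>k \<omega>. \<omega> \<in> space M \<Longrightarrow>
          x (k + 1) \<omega> = x k \<omega> + theta k *\<^sub>R (x k \<omega> - x (k - 1) \<omega>)
                        - eta (beta L b q) k *\<^sub>R S k \<omega>"

text \<open>
  Number of evaluations of the individual mappings used to compute \<open>x K\<close>, that is, in iterations
  \<open>0, \<dots>, K - 1\<close>. Iteration \<open>0\<close> evaluates the full average at \<open>x 0\<close>, which is also the first
  snapshot. A later iteration evaluates the mini-batch average at the three points
  \<open>w k\<close>, \<open>x k\<close>, \<open>x (k - 1)\<close>, and the full average at \<open>w k\<close> if the snapshot is renewed.
\<close>

definition svrg_evals :: "nat \<Rightarrow> nat \<Rightarrow> (nat \<Rightarrow> 'w \<Rightarrow> bool) \<Rightarrow> nat \<Rightarrow> 'w \<Rightarrow> nat" where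
  "svrg_evals n b Z K \<omega> =
     (\<Sum>k<K. if k = 0 then n else 3 * b + (if Z k \<omega> then n else 0))"

end

theory Submission
  imports Defs
begin

text \<open>With \<open>c\<^sub>k = \<beta> G (x\<^sub>k)\<close> and the velocity \<open>v\<^sub>k = k (x\<^sub>k - x\<^sub>k\<^sub>-\<^sub>1) + 2 k c\<^sub>k\<^sub>-\<^sub>1\<close>, the method
  reads \<open>(k + 5) (x\<^sub>k\<^sub>+\<^sub>1 - x\<^sub>k) = v\<^sub>k - 2 (k + 3) c\<^sub>k - noise\<close>, where the noise has mean zero
  given the past. The proof is a Lyapunov argument for this recursion.

  The energy \<open>\<bar>v + 2 y\<bar>\<^sup>2 / 2 + 2 \<bar>y\<bar>\<^sup>2\<close>, where \<open>y\<close> is the distance of \<open>x\<^sub>k\<close> to a zero, is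
  supplemented with a multiple of the corrector \<open>(k + 4) (k \<bar>c\<bar>\<^sup>2 - v \<bullet> c)\<close>, in which \<open>c\<close> is the
  operator value at \<open>x\<^sub>k\<^sub>-\<^sub>1\<close>. Without noise a step then loses a fixed share of \<open>\<bar>v\<^sub>k\<bar>\<^sup>2 / k\<close> and of
  \<open>k \<bar>c\<^sub>k\<bar>\<^sup>2\<close>, and by cocoercivity also a multiple of \<open>k\<^sup>2 U\<^sub>k\<close>, where \<open>U\<^sub>k\<close> is the mean over \<open>i\<close> of
  \<open>\<bar>G\<^sub>i x\<^sub>k - G\<^sub>i x\<^sub>k\<^sub>-\<^sub>1\<bar>\<^sup>2\<close> (\<open>energy_descent\<close>, \<open>increment_inner_ge\<close>).

  Noise enters the mean energy only through its variance, which the mini-batch divides by \<open>b\<close>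
  (\<open>sampling_error_moments\<close>). One part of the variance is \<open>k\<^sup>2 U\<^sub>k\<close>; the other is the gap
  between iterate and snapshot, which shrinks by the factor \<open>1 - q / 2\<close> in each step and is fed by
  \<open>2 U\<^sub>k / q\<close>. Added to the energy with a weight proportional to \<open>1 / q\<close>, the gap pays for its own
  variance at a total price proportional to \<open>U\<^sub>k / (b q\<^sup>2)\<close>. Since the step size makes \<open>1 / (\<beta> L)\<close> equal to
  \<open>2 + 128 / (b q\<^sup>2)\<close>, the cocoercive gain covers this price (\<open>noise_budget\<close>). So the mean of
  the potential decreases (\<open>potential_advance\<close>), starting below \<open>4 \<bar>x\<^sub>0 - x\<^sub>*\<bar>\<^sup>2\<close>. As it dominates
  \<open>k\<^sup>2 \<bar>x\<^sub>k - x\<^sub>k\<^sub>-\<^sub>1\<bar>\<^sup>2\<close> and \<open>k\<^sup>2 \<bar>c\<^sub>k\<^sub>-\<^sub>1\<bar>\<^sup>2\<close> up to constants, both rates follow; the complexity bound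
  combines the second one with the mean cost of an iteration.

  For the limits, the decrease of the potential shows that all dissipated quantities are summable.
  Hence \<open>\<bar>v\<^sub>k\<bar>\<^sup>2\<close>, and then the corrector, are in mean decreasing up to summable errors, while
  they are summable with weight \<open>1 / k\<close>; such sequences tend to zero
  (\<open>tendsto_0_of_almost_decreasing\<close>).

  Expectations reduce to finite sums: the state of the method at time \<open>k\<close> is a function of the
  \<open>k - 1\<close> draws made so far, whose joint law is the product law on lists (\<open>history_law\<close>), so the
  latest draw can be averaged first.\<close>

section \<open>Energy of a perturbed inertial step\<close>
text \<open>The argument \<open>v\<close> stands for the velocity \<open>k (d + 2 c)\<close>, where \<open>d\<close> is the last
  increment and \<open>c\<close> the operator value at the older point. For such \<open>v\<close> the corrector equals
  \<open>- k (k + 4) (d \<bullet> c + \<bar>c\<bar>\<^sup>2)\<close>. Pairing the increment with the older value makes a step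
  of the method produce \<open>d \<bullet> (c' - c)\<close>, \<open>c'\<close> being the new value, which cocoercivity controls,
  and keeps the corrector affine in the noise of that step.\<close>
definition corrector :: "real \<Rightarrow> 'a::real_inner \<Rightarrow> 'a \<Rightarrow> real" where
  "corrector k v c = (k + 4) * (k * (norm c)\<^sup>2 - v \<bullet> c)"

text \<open>The two squares form the familiar Lyapunov function of damped inertial dynamics with
  \<open>y\<close> the distance to a zero. The weight of the corrector has two constraints: it must be below
  \<open>1/5\<close>, because the corrector can be as negative as \<open>- (k + 4) / (4 k) \<bar>v\<bar>\<^sup>2\<close> while only
  \<open>\<bar>v\<bar>\<^sup>2 / 4\<close> of the squares is available at \<open>k = 1\<close>; and it must be large enough for the
  gain from cocoercivity to outweigh the sampling noise at \<open>k = 1\<close>.\<close>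
definition energy :: "real \<Rightarrow> 'a::real_inner \<Rightarrow> 'a \<Rightarrow> 'a \<Rightarrow> real" where
  "energy k y v c =
     (norm (v + 2 *\<^sub>R y))\<^sup>2 / 2 + 2 * (norm y)\<^sup>2 + 3/16 * corrector k v c"

text \<open>The noiseless increment of the method, as a function of the velocity and of the scaled
  operator value at the current point.\<close>
definition step :: "real \<Rightarrow> 'a::real_inner \<Rightarrow> 'a \<Rightarrow> 'a" where
  "step k v c = (1 / (k + 5)) *\<^sub>R (v - (2 * (k + 3)) *\<^sub>R c)"

definition vel :: "real \<Rightarrow> 'a::real_inner \<Rightarrow> 'a \<Rightarrow> 'a" where
  "vel k d c = k *\<^sub>R (d + 2 *\<^sub>R c)"

text \<open>The factor \<open>k + 4\<close> is chosen so that the quadratic coefficients telescope: the cross term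
  acquires the constant coefficient \<open>3\<close>, and the last term involves the old operator value
  only through its change.\<close>
lemma corrector_step:
  fixes v c e :: "'a::real_inner"
  assumes "k \<ge> 0"
  shows "corrector (k + 1) (vel (k + 1) (step k v c) c) c =
    corrector k v e + 3 * (v \<bullet> c) - (2 * k - 1) * (norm c)\<^sup>2
    - (k + 4) * ((v - (2 * k) *\<^sub>R e) \<bullet> (c - e) - k * (norm (c - e))\<^sup>2)"
proof -
  define a b where "a = (1 / (k + 5)) *\<^sub>R v" and "b = (1 / (k + 5)) *\<^sub>R c"
  \<comment> \<open>After scaling by \<open>k + 5\<close> the claim is a polynomial identity in inner products.\<close>
  have v: "v = (k + 5) *\<^sub>R a" and c: "c = (k + 5) *\<^sub>R b"
    using assms by (auto simp: a_def b_def)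
  have s: "step k v c = a - (2 * (k + 3)) *\<^sub>R b"
    by (simp add: step_def a_def b_def algebra_simps)
  show ?thesis
    unfolding corrector_def vel_def power2_norm_eq_inner s unfolding v c
    by (simp add: inner_simps inner_commute algebra_simps)
qed

lemma energy_step:
  fixes v c e y :: "'a::real_inner"
  assumes "k \<ge> 0"
  shows "energy (k + 1) (y + step k v c) (vel (k + 1) (step k v c) c) c =
    energy k y v e - (2 / (k + 5) - 4 / (k + 5)\<^sup>2) * (norm v)\<^sup>2
    + (9/16 - 16 / (k + 5) + 32 / (k + 5)\<^sup>2) * (v \<bullet> c)
    + (8 - 32 / (k + 5) + 64 / (k + 5)\<^sup>2 - 3/16 * (2 * k - 1)) * (norm c)\<^sup>2
    - 8 * (y \<bullet> c)
    - 3/16 * (k + 4) * ((v - (2 * k) *\<^sub>R e) \<bullet> (c - e) - k * (norm (c - e))\<^sup>2)"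
proof -
  define a b where "a = (1 / (k + 5)) *\<^sub>R v" and "b = (1 / (k + 5)) *\<^sub>R c"
  have v: "v = (k + 5) *\<^sub>R a" and c: "c = (k + 5) *\<^sub>R b"
    using assms by (auto simp: a_def b_def)
  have s: "step k v c = a - (2 * (k + 3)) *\<^sub>R b"
    by (simp add: step_def a_def b_def algebra_simps)
  have V: "(2 / (k + 5) - 4 / (k + 5)\<^sup>2) * (v \<bullet> v) = (2 * (k + 5) - 4) * (a \<bullet> a)"
    unfolding v using assms by (simp add: power2_eq_square divide_simps)
  have VC: "(9/16 - 16 / (k + 5) + 32 / (k + 5)\<^sup>2) * (v \<bullet> c) = (9/16 * (k+5)^2 - 16 * (k + 5) + 32) * (a \<bullet> b)"
    unfolding v c using assms by (simp add: power2_eq_square divide_simps) (simp add: algebra_simps)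
  have CC: "(8 - 32 / (k + 5) + 64 / (k + 5)\<^sup>2 - 3/16 * (2 * k - 1)) * (c \<bullet> c)
      = ((8 - 3/16 * (2 * k - 1)) * (k+5)^2 - 32 * (k + 5) + 64) * (b \<bullet> b)"
    unfolding v c using assms by (simp add: power2_eq_square divide_simps) (simp add: algebra_simps)
  have "(norm (vel (k + 1) (step k v c) c + 2 *\<^sub>R (y + step k v c)))\<^sup>2 / 2 + 2 * (norm (y + step k v c))\<^sup>2 =
    (norm (v + 2 *\<^sub>R y))\<^sup>2 / 2 + 2 * (norm y)\<^sup>2 - (2 / (k + 5) - 4 / (k + 5)\<^sup>2) * (norm v)\<^sup>2
    + (9/16 - 16 / (k + 5) + 32 / (k + 5)\<^sup>2) * (v \<bullet> c)
    + (8 - 32 / (k + 5) + 64 / (k + 5)\<^sup>2 - 3/16 * (2 * k - 1)) * (norm c)\<^sup>2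
    - 8 * (y \<bullet> c) - 3/16 * (3 * (v \<bullet> c) - (2 * k - 1) * (norm c)\<^sup>2)"
    unfolding power2_norm_eq_inner V VC CC
    unfolding vel_def s unfolding v c
    by (simp add: inner_simps inner_commute field_simps power2_eq_square)
  moreover have split: "3/16 * (p + 3 * q - r - (k + 4) * x)
      = 3/16 * p + 3/16 * (3 * q - r) - 3/16 * (k + 4) * x" for p q r x :: real
    by (simp add: field_simps)
  ultimately show ?thesis
    unfolding energy_def corrector_step[OF assms, of v c e] split by linarith
qed

text \<open>An unbiased perturbation of the increment moves the mean of the corrector not at all, the
  mean of the squared velocity and of the energy only by its variance: this is what these
  three expansions express.\<close>
lemma corrector_perturb:
  fixes v c d :: "'a::real_inner"
  shows "corrector k (vel k (s - d) c) c = corrector k (vel k s c) c + ((k * (k + 4)) *\<^sub>R c) \<bullet> d"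
  unfolding corrector_def vel_def power2_norm_eq_inner
  by (simp add: inner_simps inner_commute algebra_simps)

lemma vel_perturb:
  fixes c d :: "'a::real_inner"
  shows "(norm (vel k (s - d) c))\<^sup>2 = (norm (vel k s c))\<^sup>2 + ((- 2 * k) *\<^sub>R vel k s c) \<bullet> d + k\<^sup>2 * (norm d)\<^sup>2"
  unfolding vel_def power2_norm_eq_inner
  by (simp add: inner_simps inner_commute algebra_simps power2_eq_square)

lemma energy_perturb:
  fixes v c d y :: "'a::real_inner"
  shows "\<exists>l. \<forall>d. energy k (y + (s - d)) (vel k (s - d) c) c =
     energy k (y + s) (vel k s c) c + l \<bullet> d + ((k + 2)\<^sup>2 / 2 + 2) * (norm d)\<^sup>2"
proof (intro exI allI)
  fix d
  show "energy k (y + (s - d)) (vel k (s - d) c) c =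
     energy k (y + s) (vel k s c) c + 
     ((3/16 * (k * (k + 4))) *\<^sub>R c - (k + 2) *\<^sub>R (vel k s c + 2 *\<^sub>R (y + s)) - 4 *\<^sub>R (y + s)) \<bullet> d
     + ((k + 2)\<^sup>2 / 2 + 2) * (norm d)\<^sup>2"
    unfolding energy_def corrector_perturb
    unfolding vel_def power2_norm_eq_inner
    by (simp add: inner_simps inner_commute field_simps power2_eq_square)
qed

lemma inner_young:
  fixes v c :: "'a::real_inner"
  assumes "s > 0"
  shows "v \<bullet> c \<le> (norm v)\<^sup>2 / (2 * s) + s / 2 * (norm c)\<^sup>2"
proof -
  have "0 \<le> (norm (v - s *\<^sub>R c))\<^sup>2 / (2 * s)"
    using assms by simp
  also have "\<dots> = (norm v)\<^sup>2 / (2 * s) + s / 2 * (norm c)\<^sup>2 - v \<bullet> c"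
    unfolding power2_norm_eq_inner using assms
    by (simp add: inner_simps inner_commute field_simps)
  finally show ?thesis by simp
qed

text \<open>The hypothesis is cocoercivity against a zero, for a step size of at most \<open>1 / (6 L)\<close>. The
  term \<open>- 8 y \<bullet> c\<close> in the expansion then absorbs all constant multiples of \<open>\<bar>c\<bar>\<^sup>2\<close>,
  and the corrector supplies the multiple that grows with \<open>k\<close>. Young's inequality, with weight
  \<open>k + 5\<close> for the bounded part of the cross term and a constant weight for the part that decays
  like \<open>1 / (k + 5)\<close>, leaves a fifth of each square.\<close>
lemma energy_descent:
  fixes v c e y :: "'a::real_inner"
  assumes k: "k \<ge> 0" and y: "6 * (norm c)\<^sup>2 \<le> y \<bullet> c"
  shows "energy (k + 1) (y + step k v c) (vel (k + 1) (step k v c) c) c \<le>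
    energy k y v e - 1/5 * ((norm v)\<^sup>2 / (k + 5) + (k + 5) * (norm c)\<^sup>2)
    - 3/16 * (k + 4) * ((v - (2 * k) *\<^sub>R e) \<bullet> (c - e) - k * (norm (c - e))\<^sup>2)"
proof -
  define t where "t = k + 5"
  have t: "t \<ge> 5" using k by (simp add: t_def)
  define V C where "V = (norm v)\<^sup>2" and "C = (norm c)\<^sup>2"
  have nn: "V \<ge> 0" "C \<ge> 0" by (auto simp: V_def C_def)
  have "4 / t\<^sup>2 \<le> 4/5 / t"
    using t by (simp add: power2_eq_square divide_simps)
  then have "2 / t - 4 / t\<^sup>2 \<ge> 6/5 / t"
    using t by (simp add: field_simps)
  from mult_right_mono[OF this nn(1)]
  have 1: "(2 / t - 4 / t\<^sup>2) * V \<ge> 6/5 * (V / t)" by simp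
  have "v \<bullet> ((9/16) *\<^sub>R c) \<le> (norm v)\<^sup>2 / (2 * t) + t / 2 * (norm ((9/16) *\<^sub>R c))\<^sup>2"
    by (rule inner_young) (use t in simp)
  then have 2: "9/16 * (v \<bullet> c) \<le> 1/2 * (V / t) + 81/512 * t * C"
    by (simp add: V_def C_def power_mult_distrib power2_eq_square)
  define r where "r = - 16 + 32 / t"
  have r: "\<bar>r\<bar> \<le> 16" using t by (auto simp: r_def abs_le_iff field_simps)
  have "v \<bullet> (r *\<^sub>R c) \<le> (norm v)\<^sup>2 / (2 * 1) + 1 / 2 * (norm (r *\<^sub>R c))\<^sup>2"
    by (rule inner_young) simp
  moreover have "(norm (r *\<^sub>R c))\<^sup>2 = r\<^sup>2 * C"
    by (simp add: C_def power_mult_distrib)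
  moreover have "r\<^sup>2 * C \<le> 16\<^sup>2 * C"
    using r nn abs_le_square_iff[of r 16] by (intro mult_right_mono) auto
  ultimately have "r * (v \<bullet> c) \<le> 1/2 * V + 128 * C"
    by (simp add: V_def)
  then have "r * (v \<bullet> c) / t \<le> (1/2 * V + 128 * C) / t"
    using t by (intro divide_right_mono) auto
  moreover have "128 * C / t \<le> 128 * C / 5"
    using t nn by (intro divide_left_mono) auto
  ultimately have 3: "r * (v \<bullet> c) / t \<le> 1/2 * (V / t) + 128/5 * C"
    by (simp add: add_divide_distrib)
  have rt: "r / t = - 16 / t + 32 / t\<^sup>2"
    using t by (simp add: r_def power2_eq_square divide_simps)
  have "(9/16 - 16 / t + 32 / t\<^sup>2) * (v \<bullet> c) = 9/16 * (v \<bullet> c) + r * (v \<bullet> c) / t"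
    using arg_cong[OF rt, of "\<lambda>x. x * (v \<bullet> c)"]
    by (simp add: distrib_right left_diff_distrib)
  then have 4: "(9/16 - 16 / t + 32 / t\<^sup>2) * (v \<bullet> c) \<le> V / t + (81/512 * t + 128/5) * C"
    using 2 3 by (simp add: algebra_simps)
  have "64 / t\<^sup>2 \<le> 32 / t"
    using t by (simp add: power2_eq_square divide_simps)
  moreover have "8 - a + b - 3/16 * (2 * k - 1) - 48 + (81/512 * t + 128/5) \<le> - (1/5 * t)"
    if "b \<le> a" for a b
    using that t unfolding t_def by (simp add: field_simps)
  ultimately have "8 - 32 / t + 64 / t\<^sup>2 - 3/16 * (2 * k - 1) - 48 + (81/512 * t + 128/5) \<le> - (1/5 * t)"
    by blast
  from mult_right_mono[OF this nn(2)]
  have 5: "(8 - 32 / t + 64 / t\<^sup>2 - 3/16 * (2 * k - 1)) * C - 48 * C + (81/512 * t + 128/5) * C \<le> - (1/5 * (t * C))"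
    by (simp add: algebra_simps)
  have combine: "E - p + q + u - z - X \<le> E - 1/5 * (h + m) - X"
    if "p \<ge> 6/5 * h" "q \<le> h + s" "u - w + s \<le> - (1/5 * m)" "w \<le> z" for E p q u z X h m s w :: real
    using that by argo
  have 6: "48 * C \<le> 8 * (y \<bullet> c)" using y by (simp add: C_def)
  show ?thesis
    unfolding energy_step[OF k, of y v c e] V_def[symmetric] C_def[symmetric] t_def[symmetric]
    by (rule combine[OF 1 4 5 6])
qed

text \<open>Minimising the two squares over \<open>y\<close> leaves a quarter of \<open>\<bar>v\<bar>\<^sup>2\<close>.\<close>
lemma energy_lower:
  fixes v c y :: "'a::real_inner"
  shows "(norm v)\<^sup>2 / 4 + 3/16 * corrector k v c \<le> energy k y v c"
proof -
  have "0 \<le> (norm (v + 4 *\<^sub>R y))\<^sup>2 / 4" by simp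
  also have "\<dots> = (norm (v + 2 *\<^sub>R y))\<^sup>2 / 2 + 2 * (norm y)\<^sup>2 - (norm v)\<^sup>2 / 4"
    unfolding power2_norm_eq_inner by (simp add: inner_simps inner_commute field_simps)
  finally show ?thesis by (simp add: energy_def)
qed

text \<open>Completing the square in \<open>v\<close>; the remaining coefficient is positive because
  \<open>3/16 (k + 4) / k \<le> 15/16\<close>.\<close>
lemma operator_le_energy:
  fixes v c y :: "'a::real_inner"
  assumes k: "k \<ge> 1"
  shows "3/512 * (k + 1) * (k + 4) * (norm c)\<^sup>2 \<le> energy k y v c"
proof -
  define r where "r = 3/8 * (k + 4)"
  have "0 \<le> (norm (v - r *\<^sub>R c))\<^sup>2 / 4" by simp
  also have "\<dots> = (norm v)\<^sup>2 / 4 - r / 2 * (v \<bullet> c) + r\<^sup>2 / 4 * (norm c)\<^sup>2"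
    unfolding power2_norm_eq_inner by (simp add: inner_simps inner_commute field_simps power2_eq_square)
  also have "\<dots> = (norm v)\<^sup>2 / 4 + 3/16 * corrector k v c - 3/256 * (k + 4) * (13 * k - 12) * (norm c)\<^sup>2"
    unfolding corrector_def r_def by (simp add: field_simps power2_eq_square)
  finally have "3/256 * (k + 4) * (13 * k - 12) * (norm c)\<^sup>2 \<le> energy k y v c"
    using energy_lower[of v k c y] by simp
  moreover have "3/512 * (k + 1) * (k + 4) * (norm c)\<^sup>2 \<le> 3/256 * (k + 4) * (13 * k - 12) * (norm c)\<^sup>2"
  proof (rule mult_right_mono)
    have "3/256 * (k + 4) * ((k + 1) / 2) \<le> 3/256 * (k + 4) * (13 * k - 12)"
      using k by (intro mult_left_mono) auto
    also have "3/256 * (k + 4) * ((k + 1) / 2) = 3/512 * (k + 1) * (k + 4)"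
      by (simp add: field_simps)
    finally show "3/512 * (k + 1) * (k + 4) \<le> 3/256 * (k + 4) * (13 * k - 12)" .
  qed simp
  ultimately show ?thesis by linarith
qed

text \<open>Here the square is completed in \<open>c\<close> instead, after writing the velocity through the increment.\<close>
lemma increment_le_energy:
  fixes d c y :: "'a::real_inner"
  assumes k: "k \<ge> 1"
  shows "3/320 * (k + 4)\<^sup>2 * (norm d)\<^sup>2 \<le> energy k y (vel k d c) c"
proof -
  have "0 \<le> (13 * k - 12) * k / 16 * (norm (c + (1/2) *\<^sub>R d))\<^sup>2"
    using k by simp
  also have "\<dots> = (norm (vel k d c))\<^sup>2 / 4 + 3/16 * corrector k (vel k d c) c
      - 3/64 * (k * (k + 4)) * (norm d)\<^sup>2"
    unfolding power2_norm_eq_inner corrector_def vel_def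
    by (simp add: inner_simps inner_commute field_simps power2_eq_square)
  finally have "3/64 * (k * (k + 4)) * (norm d)\<^sup>2 \<le> energy k y (vel k d c) c"
    using energy_lower[of "vel k d c" k c y] by simp
  moreover have "3/320 * (k + 4)\<^sup>2 * (norm d)\<^sup>2 \<le> 3/64 * (k * (k + 4)) * (norm d)\<^sup>2"
  proof (rule mult_right_mono)
    have "3/320 * (k + 4) * (k + 4) \<le> 3/320 * (5 * k) * (k + 4)"
      using k by (intro mult_right_mono mult_left_mono) auto
    also have "\<dots> = 3/64 * (k * (k + 4))" by simp
    finally show "3/320 * (k + 4)\<^sup>2 \<le> 3/64 * (k * (k + 4))"
      by (simp only: power2_eq_square mult.assoc)
  qed simp
  ultimately show ?thesis by linarith
qed

text \<open>Adding \<open>5/2 \<bar>v\<bar>\<^sup>2\<close> makes the corrector nonnegative and comparable to \<open>k\<^sup>2 \<bar>c\<bar>\<^sup>2\<close> up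
  to the velocity, so that a limit for the corrector becomes a limit for the operator value.\<close>
lemma corrector_bounds:
  fixes v c :: "'a::real_inner"
  assumes k: "k \<ge> 1"
  shows "1/2 * (k\<^sup>2 * (norm c)\<^sup>2) \<le> corrector k v c + 5/2 * (norm v)\<^sup>2"
    and "corrector k v c + 5/2 * (norm v)\<^sup>2 \<le> 5 * (norm v)\<^sup>2 + 8 * (k\<^sup>2 * (norm c)\<^sup>2)"
proof -
  define V P where "V = (norm v)\<^sup>2" and "P = k\<^sup>2 * (norm c)\<^sup>2"
  define r where "r = (k + 4) / k"
  have r: "1 \<le> r" "r \<le> 5" and rk: "r * k = k + 4"
    using k by (auto simp: r_def field_simps)
  have nn: "V \<ge> 0" "P \<ge> 0" by (auto simp: V_def P_def)
  have corr: "corrector k v c = r * (P - v \<bullet> (k *\<^sub>R c))"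
    unfolding corrector_def rk[symmetric] P_def by (simp add: algebra_simps power2_eq_square)
  have nk: "(norm (k *\<^sub>R c))\<^sup>2 = P" by (simp add: P_def power_mult_distrib)
  have a: "v \<bullet> (k *\<^sub>R c) \<le> V / 2 + P / 2"
    using inner_young[of 1 v "k *\<^sub>R c"] unfolding nk V_def by simp
  have b: "- (v \<bullet> (k *\<^sub>R c)) \<le> V / 2 + P / 2"
    using inner_young[of 1 "-v" "k *\<^sub>R c"] unfolding nk V_def by simp
  have "r * (P - v \<bullet> (k *\<^sub>R c)) \<ge> r * (P / 2 - V / 2)"
    using a r by (intro mult_left_mono) auto
  moreover have "r * P \<ge> 1 * P" "r * V \<le> 5 * V"
    using r nn by (intro mult_right_mono; simp)+
  ultimately show "1/2 * (k\<^sup>2 * (norm c)\<^sup>2) \<le> corrector k v c + 5/2 * (norm v)\<^sup>2"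
    unfolding corr P_def[symmetric] V_def[symmetric] by (simp add: algebra_simps)
  have "r * (P - v \<bullet> (k *\<^sub>R c)) \<le> r * (3/2 * P + V / 2)"
    using b r by (intro mult_left_mono) auto
  moreover have "r * (3/2 * P + V / 2) \<le> 5 * (3/2 * P + V / 2)"
    using r nn by (intro mult_right_mono) auto
  ultimately have "corrector k v c \<le> 15/2 * P + 5/2 * V"
    unfolding corr by (simp add: algebra_simps)
  then have "corrector k v c + 5/2 * V \<le> 5 * V + 8 * P"
    using nn by simp
  then show "corrector k v c + 5/2 * (norm v)\<^sup>2 \<le> 5 * (norm v)\<^sup>2 + 8 * (k\<^sup>2 * (norm c)\<^sup>2)"
    unfolding P_def V_def .
qed

lemma vel_step_le:
  fixes v c :: "'a::real_inner"
  assumes k: "k \<ge> 0"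
  shows "(norm (vel (k + 1) (step k v c) c))\<^sup>2
    \<le> (norm v)\<^sup>2 + (norm v)\<^sup>2 / (k + 5) + 20 * ((k + 5) * (norm c)\<^sup>2)"
proof -
  have "2 - 2 * (k + 3) / (k + 5) = 4 / (k + 5)"
    using k by (simp add: divide_simps)
  moreover have "step k v c + 2 *\<^sub>R c = (1 / (k + 5)) *\<^sub>R v + (2 - 2 * (k + 3) / (k + 5)) *\<^sub>R c"
    by (simp add: step_def scaleR_diff_right scaleR_diff_left)
  ultimately have "vel (k + 1) (step k v c) c = ((k + 1) / (k + 5)) *\<^sub>R (v + 4 *\<^sub>R c)"
    by (simp add: vel_def scaleR_add_right)
  then have "(norm (vel (k + 1) (step k v c) c))\<^sup>2 = ((k + 1) / (k + 5))\<^sup>2 * (norm (v + 4 *\<^sub>R c))\<^sup>2"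
    using k by (simp add: power_mult_distrib power_divide)
  also have "\<dots> \<le> 1 * (norm (v + 4 *\<^sub>R c))\<^sup>2"
    using k by (intro mult_right_mono) (auto simp: power_le_one)
  also have "\<dots> = (norm v)\<^sup>2 + 8 * (v \<bullet> c) + 16 * (norm c)\<^sup>2"
    unfolding power2_norm_eq_inner by (simp add: inner_simps inner_commute)
  also have "8 * (v \<bullet> c) \<le> (norm v)\<^sup>2 / (k + 5) + 16 * ((k + 5) * (norm c)\<^sup>2)"
    using inner_young[of "(k + 5) / 2" v "8 *\<^sub>R c"] k
    by (simp add: power_mult_distrib nonzero_mult_div_cancel_left[of 2 "k + 5"] del: distrib_left_numeral)
  also have "16 * (norm c)\<^sup>2 \<le> 4 * ((k + 5) * (norm c)\<^sup>2)"
    using mult_right_mono[of 4 "k + 5" "(norm c)\<^sup>2"] k by simp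
  finally show ?thesis by simp
qed


section \<open>Descent inequalities and limits\<close>
lemma summable_of_decrease:
  fixes l f :: "nat \<Rightarrow> real"
  assumes "\<And>k. l (Suc k) + f k \<le> l k" "\<And>k. f k \<ge> 0" "\<And>k. l k \<ge> 0"
  shows "summable f"
proof -
  have "(\<Sum>j<m. f j) + l m \<le> l 0" for m
  proof (induction m)
    case (Suc m)
    then show ?case using assms(1)[of m] by simp
  qed simp
  then have "(\<Sum>j<m. f j) \<le> l 0" for m
    using assms(3)[of m] by (meson add_increasing2 order_trans order_refl)
  then show ?thesis
    by (intro bounded_imp_summable[where B = "l 0"] assms(2)) (metis lessThan_Suc_atMost)
qed

text \<open>Up to a summable error the sequence decreases, so it has a limit; a positive limit would make
  the harmonic series summable. This upgrades bounds \<open>O (1 / k\<^sup>2)\<close> to \<open>o (1 / k\<^sup>2)\<close>.\<close>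
lemma tendsto_0_of_almost_decreasing:
  fixes a f :: "nat \<Rightarrow> real"
  assumes a: "\<And>k. a k \<ge> 0"
    and step: "\<And>k. a (Suc k) \<le> a k + f k"
    and f: "summable f" and s: "summable (\<lambda>k. a k / real (Suc k))"
  shows "a \<longlonglongrightarrow> 0"
proof -
  define c where "c = (\<lambda>k. a k - (\<Sum>j<k. f j))"
  have dec: "decseq c"
    by (rule decseq_SucI) (use step in \<open>simp add: c_def algebra_simps\<close>)
  have lim_f: "(\<lambda>k. \<Sum>j<k. f j) \<longlonglongrightarrow> suminf f"
    by (rule summable_LIMSEQ[OF f])
  obtain K where K: "(\<Sum>j<k. f j) \<le> K" for k
    using convergent_imp_Bseq[OF convergentI[OF lim_f]] unfolding Bseq_def
    by (metis abs_le_D1 real_norm_def)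
  have "- K \<le> c k" for k
    using K[of k] a[of k] by (simp add: c_def)
  then obtain m where m: "c \<longlonglongrightarrow> m"
    using decseq_convergent[OF dec] by blast
  define l where "l = m + suminf f"
  have "(\<lambda>k. c k + (\<Sum>j<k. f j)) \<longlonglongrightarrow> l"
    unfolding l_def by (intro tendsto_add m lim_f)
  then have lim: "a \<longlonglongrightarrow> l"
    by (simp add: c_def)
  have "l \<ge> 0"
    using lim by (rule LIMSEQ_le_const) (use a in auto)
  moreover have "\<not> l > 0"
  proof
    assume l: "l > 0"
    then have "eventually (\<lambda>k. a k > l / 2) sequentially"
      using lim by (intro order_tendstoD) auto
    then have "eventually (\<lambda>k. norm (l / 2 * (1 / real (Suc k))) \<le> a k / real (Suc k)) sequentially"
      by eventually_elim (use l in \<open>simp add: divide_right_mono flip: divide_divide_eq_left\<close>)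
    then have "summable (\<lambda>k. l / 2 * (1 / real (Suc k)))"
      by (rule summable_comparison_test_ev) (rule s)
    then have "summable (\<lambda>k. 1 / real (Suc k))"
      using l by (subst (asm) summable_cmult_iff) auto
    then have "summable (\<lambda>k. inverse (real k))"
      using summable_Suc_iff[of "\<lambda>k. inverse (real k)"] by (simp add: inverse_eq_divide)
    then show False using not_summable_harmonic[where 'a=real] by (simp add: inverse_eq_divide)
  qed
  ultimately have "l = 0" by simp
  then show ?thesis using lim by simp
qed


section \<open>Mean squares over a finite family\<close>
definition mean_sq :: "nat \<Rightarrow> (nat \<Rightarrow> 'a::real_inner) \<Rightarrow> real" where
  "mean_sq n f = (1 / real n) * (\<Sum>i=1..n. (norm (f i))\<^sup>2)"

lemma mean_sq_nonneg: "mean_sq n f \<ge> 0"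
  by (simp add: mean_sq_def sum_nonneg)

lemma mean_sq_centered:
  fixes f :: "nat \<Rightarrow> 'a::real_inner"
  assumes "n \<ge> 1" and m: "m = (1 / real n) *\<^sub>R (\<Sum>i=1..n. f i)"
  shows "mean_sq n (\<lambda>i. f i - m) = mean_sq n f - (norm m)\<^sup>2"
proof -
  have s: "(\<Sum>i=1..n. f i) = real n *\<^sub>R m"
    using assms by simp
  have "(\<Sum>i=1..n. (norm (f i - m))\<^sup>2) = (\<Sum>i=1..n. (norm (f i))\<^sup>2) - 2 * ((\<Sum>i=1..n. f i) \<bullet> m) + real n * (norm m)\<^sup>2"
    unfolding power2_norm_eq_inner
    by (simp add: inner_diff_left inner_diff_right sum.distrib sum_subtractf inner_sum_left inner_sum_right inner_commute
      sum_distrib_left algebra_simps)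
  also have "\<dots> = (\<Sum>i=1..n. (norm (f i))\<^sup>2) - real n * (norm m)\<^sup>2"
    unfolding s by (simp add: power2_norm_eq_inner)
  finally show ?thesis
    using assms(1) by (simp add: mean_sq_def right_diff_distrib)
qed

text \<open>The variance is nonnegative.\<close>
lemma norm_mean_le_mean_sq:
  fixes f :: "nat \<Rightarrow> 'a::real_inner"
  assumes "n \<ge> 1"
  shows "(norm ((1 / real n) *\<^sub>R (\<Sum>i=1..n. f i)))\<^sup>2 \<le> mean_sq n f"
  using mean_sq_centered[OF assms refl, of f] mean_sq_nonneg by (metis diff_ge_0_iff_ge)

lemma mean_sq_scale: "mean_sq n (\<lambda>i. r *\<^sub>R f i) = r\<^sup>2 * mean_sq n f"
  by (simp add: mean_sq_def power_mult_distrib sum_distrib_left algebra_simps)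

lemma norm_add_sq_le:
  fixes a b :: "'a::real_inner"
  assumes "r > 0"
  shows "(norm (a + b))\<^sup>2 \<le> (1 + r) * (norm a)\<^sup>2 + (1 + 1 / r) * (norm b)\<^sup>2"
proof -
  have "(norm (a + b))\<^sup>2 = (norm a)\<^sup>2 + 2 * (b \<bullet> a) + (norm b)\<^sup>2"
    unfolding power2_norm_eq_inner by (simp add: inner_simps inner_commute)
  then show ?thesis using inner_young[OF assms, of b a] by (simp add: algebra_simps)
qed

lemma mean_sq_add_le:
  assumes "r > 0"
  shows "mean_sq n (\<lambda>i. f i + g i) \<le> (1 + r) * mean_sq n f + (1 + 1 / r) * mean_sq n g"
proof -
  have "(\<Sum>i=1..n. (norm (f i + g i))\<^sup>2) \<le> (\<Sum>i=1..n. (1 + r) * (norm (f i))\<^sup>2 + (1 + 1 / r) * (norm (g i))\<^sup>2)"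
    by (intro sum_mono norm_add_sq_le assms)
  also have "\<dots> = (1 + r) * (\<Sum>i=1..n. (norm (f i))\<^sup>2) + (1 + 1 / r) * (\<Sum>i=1..n. (norm (g i))\<^sup>2)"
    by (simp add: sum.distrib sum_distrib_left)
  finally have "(1 / real n) * (\<Sum>i=1..n. (norm (f i + g i))\<^sup>2)
     \<le> (1 / real n) * ((1 + r) * (\<Sum>i=1..n. (norm (f i))\<^sup>2) + (1 + 1 / r) * (\<Sum>i=1..n. (norm (g i))\<^sup>2))"
    by (intro mult_left_mono) auto
  also have "\<dots> = (1 + r) * mean_sq n f + (1 + 1 / r) * mean_sq n g"
    unfolding mean_sq_def by argo
  finally show ?thesis unfolding mean_sq_def .
qed

lemma avg_cocoerciveD:
  assumes "avg_cocoercive n G L"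
  shows "(1 / L) * mean_sq n (\<lambda>i. G i x - G i y) \<le> (finite_avg n G x - finite_avg n G y) \<bullet> (x - y)"
proof -
  have "(finite_avg n G x - finite_avg n G y) \<bullet> (x - y) = (1 / real n) * (\<Sum>i=1..n. (G i x - G i y) \<bullet> (x - y))"
    by (simp only: finite_avg_def inner_sum_left sum_subtractf inner_scaleR_left inner_diff_left
        flip: scaleR_diff_right)
  then show ?thesis
    using assms unfolding avg_cocoercive_def mean_sq_def by simp
qed

lemma norm_finite_avg_diff_le:
  assumes "n \<ge> 1"
  shows "(norm (finite_avg n G x - finite_avg n G y))\<^sup>2 \<le> mean_sq n (\<lambda>i. G i x - G i y)"
  using norm_mean_le_mean_sq[OF assms, of "\<lambda>i. G i x - G i y"]
  by (simp add: finite_avg_def sum_subtractf scaleR_diff_right)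

section \<open>Mini-batches\<close>
lemma expectation_bind_finite:
  fixes h :: "'b \<Rightarrow> real"
  assumes "finite (set_pmf p)" "\<And>x. x \<in> set_pmf p \<Longrightarrow> finite (set_pmf (f x))"
  shows "measure_pmf.expectation (bind_pmf p f) h = measure_pmf.expectation p (\<lambda>x. measure_pmf.expectation (f x) h)"
proof -
  have "measure_pmf.expectation (bind_pmf p f) h
      = (\<Sum>x\<in>set_pmf p. pmf p x *\<^sub>R measure_pmf.expectation (f x) h)"
    by (rule pmf_expectation_bind[OF assms(1) assms(2)]) auto
  also have "\<dots> = measure_pmf.expectation p (\<lambda>x. measure_pmf.expectation (f x) h)"
    by (rule integral_measure_pmf[OF assms(1), symmetric])
  finally show ?thesis .
qed

lemma finite_set_replicate_pmf:
  assumes "finite (set_pmf p)"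
  shows "finite (set_pmf (replicate_pmf n p))"
proof -
  have "set_pmf (replicate_pmf n p) = {xs. set xs \<subseteq> set_pmf p \<and> length xs = n}"
    by (auto simp: set_replicate_pmf)
  then show ?thesis using finite_lists_length_eq[OF assms, of n] by simp
qed

lemma expectation_replicate_pmf_Suc_first:
  fixes h :: "'a list \<Rightarrow> real"
  assumes "finite (set_pmf p)"
  shows "measure_pmf.expectation (replicate_pmf (Suc n) p) h =
     measure_pmf.expectation p (\<lambda>x. measure_pmf.expectation (replicate_pmf n p) (\<lambda>xs. h (x # xs)))"
  using assms finite_set_replicate_pmf[OF assms, of n]
  by (simp add: expectation_bind_finite)

lemma expectation_pair_pmf_finite:
  fixes h :: "'a \<times> 'b \<Rightarrow> real"
  assumes "finite (set_pmf p)" "finite (set_pmf r)"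
  shows "measure_pmf.expectation (pair_pmf p r) h =
     measure_pmf.expectation p (\<lambda>x. measure_pmf.expectation r (\<lambda>y. h (x, y)))"
  using assms by (simp add: pair_pmf_def expectation_bind_finite)

lemma expectation_mono_finite:
  fixes f h :: "'a \<Rightarrow> real"
  assumes "finite (set_pmf p)" "\<And>x. x \<in> set_pmf p \<Longrightarrow> f x \<le> h x"
  shows "measure_pmf.expectation p f \<le> measure_pmf.expectation p h"
  using assms by (intro integral_mono_AE integrable_measure_pmf_finite) (auto simp: AE_measure_pmf_iff)

lemma expectation_cong_pmf:
  fixes f h :: "'a \<Rightarrow> real"
  assumes "\<And>x. x \<in> set_pmf p \<Longrightarrow> f x = h x"
  shows "measure_pmf.expectation p f = measure_pmf.expectation p h"
  using assms by (intro integral_cong_AE) (auto simp: AE_measure_pmf_iff)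

text \<open>Independent centred draws have vanishing cross terms, so that second moments add up.\<close>
lemma minibatch_moments:
  fixes f :: "nat \<Rightarrow> 'a::{real_inner}"
  assumes n: "n \<ge> 1" and s: "(\<Sum>i=1..n. f i) = 0"
  defines "P \<equiv> \<lambda>b. replicate_pmf b (pmf_of_set {1..n})"
  shows "measure_pmf.expectation (P b) (\<lambda>B. l \<bullet> (\<Sum>i\<leftarrow>B. f i)) = 0"
    and "measure_pmf.expectation (P b) (\<lambda>B. (norm (\<Sum>i\<leftarrow>B. f i))\<^sup>2) = real b * mean_sq n f"
proof -
  have ne: "{1..n} \<noteq> {}" "finite {1..n}" using n by auto
  have fin: "finite (set_pmf (pmf_of_set {1..n}))" using ne by simp
  have finP: "finite (set_pmf (P b))" for b
    unfolding P_def by (rule finite_set_replicate_pmf[OF fin])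
  have int: "integrable (measure_pmf (P b)) h" for b and h :: "nat list \<Rightarrow> real"
    by (rule integrable_measure_pmf_finite[OF finP])
  have exp_Suc: "measure_pmf.expectation (P (Suc b)) h =
     (\<Sum>i=1..n. measure_pmf.expectation (P b) (\<lambda>xs. h (i # xs))) / real n" for b and h :: "nat list \<Rightarrow> real"
    unfolding P_def
    by (rule trans[OF expectation_replicate_pmf_Suc_first[OF fin]]) (use integral_pmf_of_set[OF ne] in simp)
  show lin: "measure_pmf.expectation (P b) (\<lambda>B. l \<bullet> (\<Sum>i\<leftarrow>B. f i)) = 0" for b l
  proof (induction b)
    case (Suc b)
    have "(\<Sum>i=1..n. l \<bullet> f i) = 0" using s by (metis inner_sum_right inner_zero_right)
    moreover have "measure_pmf.expectation (P b) (\<lambda>B. l \<bullet> (\<Sum>j\<leftarrow>i # B. f j)) = l \<bullet> f i" for i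
    proof -
      have "measure_pmf.expectation (P b) (\<lambda>B. l \<bullet> (\<Sum>j\<leftarrow>i # B. f j))
        = measure_pmf.expectation (P b) (\<lambda>B. l \<bullet> f i + l \<bullet> (\<Sum>j\<leftarrow>B. f j))"
        by (simp add: inner_add_right)
      also have "\<dots> = l \<bullet> f i"
        by (subst Bochner_Integration.integral_add[OF int int]) (simp add: Suc.IH)
      finally show ?thesis .
    qed
    ultimately show ?case
      unfolding exp_Suc by simp
  qed (simp add: P_def)
  show "measure_pmf.expectation (P b) (\<lambda>B. (norm (\<Sum>i\<leftarrow>B. f i))\<^sup>2) = real b * mean_sq n f"
  proof (induction b)
    case (Suc b)
    have e: "(norm (f i + y))\<^sup>2 = (norm (f i))\<^sup>2 + (2 *\<^sub>R f i) \<bullet> y + (norm y)\<^sup>2" for i y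
      unfolding power2_norm_eq_inner by (simp add: inner_simps inner_commute)
    have "measure_pmf.expectation (P b) (\<lambda>B. (norm (\<Sum>j\<leftarrow>i # B. f j))\<^sup>2)
        = (norm (f i))\<^sup>2 + real b * mean_sq n f" for i
    proof -
      have "measure_pmf.expectation (P b) (\<lambda>B. (norm (\<Sum>j\<leftarrow>i # B. f j))\<^sup>2)
        = measure_pmf.expectation (P b) (\<lambda>B. ((norm (f i))\<^sup>2 + (2 *\<^sub>R f i) \<bullet> (\<Sum>j\<leftarrow>B. f j))
            + (norm (\<Sum>j\<leftarrow>B. f j))\<^sup>2)"
        by (simp only: list.map sum_list.Cons e)
      also have "\<dots> = (norm (f i))\<^sup>2 + real b * mean_sq n f"
        by (subst Bochner_Integration.integral_add[OF int int],
            subst Bochner_Integration.integral_add[OF int int]) (simp only: lin Suc.IH, simp)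
      finally show ?thesis .
    qed
    note inner = this
    have "real n * mean_sq n f = (\<Sum>i=1..n. (norm (f i))\<^sup>2)"
      using n by (simp add: mean_sq_def)
    then show ?case
      unfolding exp_Suc inner sum.distrib using n by (simp add: field_simps)
  qed (simp add: P_def)
qed

text \<open>Averaging \<open>b\<close> draws divides the variance by \<open>b\<close>; the variance is at most the mean square.\<close>
lemma minibatch_error:
  fixes f :: "nat \<Rightarrow> 'a::real_inner"
  assumes n: "n \<ge> 1" and b: "b \<ge> 1"
  defines "P \<equiv> replicate_pmf b (pmf_of_set {1..n})"
    and "e \<equiv> \<lambda>B. (1 / real b) *\<^sub>R (\<Sum>i\<leftarrow>B. f i) - (1 / real n) *\<^sub>R (\<Sum>i=1..n. f i)"
  shows "measure_pmf.expectation P (\<lambda>B. l \<bullet> e B) = 0"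
    and "measure_pmf.expectation P (\<lambda>B. (norm (e B))\<^sup>2) \<le> mean_sq n f / real b"
proof -
  define m where "m = (1 / real n) *\<^sub>R (\<Sum>i=1..n. f i)"
  have c: "(\<Sum>i=1..n. f i - m) = 0"
    using n by (simp add: sum_subtractf sum_constant_scaleR m_def del: sum_constant)
  have sum_const: "(\<Sum>i\<leftarrow>B. f i - m) = (\<Sum>i\<leftarrow>B. f i) - real (length B) *\<^sub>R m" for B
    by (induction B) (auto simp: algebra_simps)
  \<comment> \<open>Every list in the support has length \<open>b\<close>, which turns the error into a sum of centred draws.\<close>
  have eB: "e B = (1 / real b) *\<^sub>R (\<Sum>i\<leftarrow>B. f i - m)" if "B \<in> set_pmf P" for B
  proof -
    have "length B = b" using that by (simp add: P_def set_replicate_pmf)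
    then show ?thesis
      using b unfolding e_def m_def[symmetric] sum_const by (simp add: scaleR_diff_right)
  qed
  have "measure_pmf.expectation P (\<lambda>B. l \<bullet> e B) = measure_pmf.expectation P (\<lambda>B. (1 / real b) * (l \<bullet> (\<Sum>i\<leftarrow>B. f i - m)))"
    by (rule expectation_cong_pmf) (simp only: eB inner_scaleR_right)
  then show "measure_pmf.expectation P (\<lambda>B. l \<bullet> e B) = 0"
    using minibatch_moments(1)[OF n c, of b l] by (simp only: P_def integral_mult_right_zero mult_zero_right)
  have "measure_pmf.expectation P (\<lambda>B. (norm (e B))\<^sup>2)
      = measure_pmf.expectation P (\<lambda>B. (1 / real b)\<^sup>2 * (norm (\<Sum>i\<leftarrow>B. f i - m))\<^sup>2)"
    by (rule expectation_cong_pmf) (simp add: eB power_mult_distrib power_divide)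
  also have "\<dots> = (1 / real b)\<^sup>2 * (real b * mean_sq n (\<lambda>i. f i - m))"
    using minibatch_moments(2)[OF n c, of b] by (simp only: P_def integral_mult_right_zero)
  also have "\<dots> = mean_sq n (\<lambda>i. f i - m) / real b"
    by (simp add: power2_eq_square)
  also have "\<dots> \<le> mean_sq n f / real b"
    using mean_sq_centered[OF n m_def] by (simp add: divide_right_mono)
  finally show "measure_pmf.expectation P (\<lambda>B. (norm (e B))\<^sup>2) \<le> mean_sq n f / real b" .
qed

section \<open>Histories of independent draws\<close>
lemma replicate_pmf_Suc_map: "replicate_pmf (Suc k) p = map_pmf (\<lambda>(x, xs). x # xs) (pair_pmf p (replicate_pmf k p))"
  by (simp add: pair_pmf_def map_bind_pmf map_pmf_def[symmetric] bind_assoc_pmf bind_return_pmf pmf.map_comp o_def)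

lemma pmf_replicate_pmf:
  "pmf (replicate_pmf k p) l = (if length l = k then \<Prod>j=1..k. pmf p (l ! (k - j)) else 0)"
proof (induction k arbitrary: l)
  case 0
  then show ?case by (auto simp: pmf_return indicator_def)
next
  case (Suc k)
  show ?case
  proof (cases l)
    case Nil
    have "[] \<notin> set_pmf (replicate_pmf (Suc k) p)"
      by (simp only: set_replicate_pmf) simp
    then have "pmf (replicate_pmf (Suc k) p) [] = 0"
      by (simp only: set_pmf_iff not_not)
    then show ?thesis using Nil by (simp del: replicate_pmf.simps)
  next
    case (Cons a m)
    have inj: "inj (\<lambda>(x, xs). x # xs)" by (auto simp: inj_def)
    have "pmf (replicate_pmf (Suc k) p) (a # m) = pmf (pair_pmf p (replicate_pmf k p)) (a, m)"
      unfolding replicate_pmf_Suc_map using pmf_map_inj'[OF inj, of _ "(a, m)"] by simp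
    also have "\<dots> = pmf p a * (if length m = k then \<Prod>j=1..k. pmf p (m ! (k - j)) else 0)"
      unfolding pmf_pair Suc.IH ..
    also have "(\<Prod>j=1..k. pmf p (m ! (k - j))) = (\<Prod>j=1..k. pmf p ((a # m) ! (Suc k - j)))"
      by (rule prod.cong) (auto simp: Suc_diff_le)
    finally show ?thesis unfolding Cons by (simp add: mult.commute del: replicate_pmf.simps)
  qed
qed

text \<open>The head of the list is the latest draw of a history. Integrating it first, with the earlier
  draws fixed, is conditioning on the past.\<close>
lemma expectation_replicate_pmf_Suc_last:
  fixes h :: "'a list \<Rightarrow> real"
  assumes "finite (set_pmf p)"
  shows "measure_pmf.expectation (replicate_pmf (Suc n) p) h =
     measure_pmf.expectation (replicate_pmf n p) (\<lambda>xs. measure_pmf.expectation p (\<lambda>x. h (x # xs)))"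
proof -
  have "replicate_pmf (Suc n) p = bind_pmf (replicate_pmf n p) (\<lambda>xs. map_pmf (\<lambda>x. x # xs) p)"
    unfolding map_pmf_def by (simp add: bind_commute_pmf[of p])
  then show ?thesis
    using assms finite_set_replicate_pmf[OF assms, of n]
    by (simp add: expectation_bind_finite del: replicate_pmf.simps)
qed

text \<open>Indices start at \<open>1\<close>, and the latest value comes first.\<close>
primrec history :: "(nat \<Rightarrow> 'w \<Rightarrow> 'b) \<Rightarrow> nat \<Rightarrow> 'w \<Rightarrow> 'b list" where
  "history X 0 \<omega> = []"
| "history X (Suc k) \<omega> = X (Suc k) \<omega> # history X k \<omega>"

lemma length_history [simp]: "length (history X k \<omega>) = k"
  by (induction k) auto

lemma nth_history: "j \<in> {1..k} \<Longrightarrow> history X k \<omega> ! (k - j) = X j \<omega>"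
proof (induction k)
  case (Suc k)
  then show ?case by (cases "j = Suc k") (auto simp: Suc_diff_le)
qed simp

lemma history_eq_iff: "history X k \<omega> = l \<longleftrightarrow> length l = k \<and> (\<forall>j\<in>{1..k}. X j \<omega> = l ! (k - j))"
proof
  assume "length l = k \<and> (\<forall>j\<in>{1..k}. X j \<omega> = l ! (k - j))"
  then have "history X k \<omega> ! i = l ! i" if "i < k" for i
    using nth_history[of "k - i" k X \<omega>] that by auto
  then show "history X k \<omega> = l"
    using \<open>length l = k \<and> _\<close> by (intro nth_equalityI) auto
qed (auto simp: nth_history)

context prob_space
begin

text \<open>On a countable type the law is determined by the probabilities of single lists, and these
  factor by independence.\<close>
lemma history_law:
  fixes X :: "nat \<Rightarrow> 'a \<Rightarrow> 'b::countable"
  assumes indep: "indep_vars (\<lambda>_. count_space UNIV) X {1..}"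
    and law: "\<And>k. k \<ge> 1 \<Longrightarrow> distr M (count_space UNIV) (X k) = measure_pmf p"
  shows "history X k \<in> measurable M (count_space UNIV)"
    and "distr M (count_space UNIV) (history X k) = measure_pmf (replicate_pmf k p)"
proof -
  have rv: "X j \<in> measurable M (count_space UNIV)" if "j \<ge> 1" for j
    using indep that by (auto simp: indep_vars_def)
  have prob_X: "prob (X j -` {c} \<inter> space M) = pmf p c" if "j \<ge> 1" for j c
  proof -
    have "pmf p c = measure (distr M (count_space UNIV) (X j)) {c}"
      using law[OF that] by (simp add: measure_pmf_single)
    then show ?thesis by (subst (asm) measure_distr) (use rv[OF that] in auto)
  qed
  have pre: "history X k -` {l} \<inter> space M = (if length l = k then space M \<inter> (\<Inter>j\<in>{1..k}. X j -` {l ! (k - j)} \<inter> space M) else {})" for k l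
    by (auto simp: history_eq_iff)
  have ev: "history X k -` {l} \<inter> space M \<in> events" for k l
  proof (cases "length l = k \<and> k \<noteq> 0")
    case True
    then have "(\<Inter>j\<in>{1..k}. X j -` {l ! (k - j)} \<inter> space M) \<in> events"
      by (intro sets.finite_INT measurable_sets[OF rv]) auto
    then show ?thesis unfolding pre by simp
  qed (auto simp: pre)
  then show meas: "history X k \<in> measurable M (count_space UNIV)" for k
    by (simp add: measurable_count_space_eq2_countable)
  have prob_h: "prob (history X k -` {l} \<inter> space M) = pmf (replicate_pmf k p) l" for l
  proof (cases "length l = k \<and> k \<noteq> 0")
    case True
    then have "history X k -` {l} \<inter> space M = (\<Inter>j\<in>{1..k}. X j -` {l ! (k - j)} \<inter> space M)"
      unfolding pre by auto
    also have "prob \<dots> = (\<Prod>j=1..k. prob (X j -` {l ! (k - j)} \<inter> space M))"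
      using True by (intro indep_varsD[OF indep]) auto
    also have "\<dots> = (\<Prod>j=1..k. pmf p (l ! (k - j)))"
      by (rule prod.cong) (auto simp: prob_X)
    finally show ?thesis using True by (simp add: pmf_replicate_pmf)
  next
    case False
    then show ?thesis by (auto simp: pre pmf_replicate_pmf prob_space)
  qed
  show "distr M (count_space UNIV) (history X k) = measure_pmf (replicate_pmf k p)"
  proof (rule measure_eqI_countable)
    fix l :: "'b list"
    show "emeasure (distr M (count_space UNIV) (history X k)) {l} = emeasure (measure_pmf (replicate_pmf k p)) {l}"
      by (subst emeasure_distr[OF meas]) (auto simp: emeasure_eq_measure prob_h emeasure_pmf_single)
  qed auto
qed

end

section \<open>The iteration as a chain of states\<close>
context vfkm_svrg
begin

abbreviation g :: "real^'p \<Rightarrow> real^'p" where "g \<equiv> finite_avg n G"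
abbreviation \<beta> :: real where "\<beta> \<equiv> beta L b q"

definition draw_pmf :: "(bool \<times> nat list) pmf" where
  "draw_pmf = pair_pmf (bernoulli_pmf q) (replicate_pmf b (pmf_of_set {1..n}))"

definition estimate :: "nat \<Rightarrow> real^'p \<Rightarrow> real^'p \<Rightarrow> real^'p \<Rightarrow> nat list \<Rightarrow> real^'p" where
  "estimate k xc xp u bs = (1 - gam k) *\<^sub>R (g u - batch_avg b G bs u)
     + batch_avg b G bs xc - gam k *\<^sub>R batch_avg b G bs xp"

fun advance :: "nat \<Rightarrow> (real^'p) \<times> (real^'p) \<times> (real^'p) \<Rightarrow> bool \<times> nat list \<Rightarrow> (real^'p) \<times> (real^'p) \<times> (real^'p)" where
  "advance k (xc, xp, u) (z, bs) =
     (xc + theta k *\<^sub>R (xc - xp) - eta \<beta> k *\<^sub>R estimate k xc xp (if z then xp else u) bs,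
      xc, if z then xp else u)"

text \<open>A state at time \<open>k\<close> holds the current iterate, the previous iterate and the previous
  snapshot. The empty history leads to time \<open>1\<close>: the first step uses the exact operator value,
  hence no draw.\<close>
primrec run :: "(bool \<times> nat list) list \<Rightarrow> (real^'p) \<times> (real^'p) \<times> (real^'p)" where
  "run [] = (x0 - eta \<beta> 0 *\<^sub>R g x0, x0, x0)"
| "run (d # ds) = advance (Suc (length ds)) (run ds) d"

definition state :: "nat \<Rightarrow> 'w \<Rightarrow> (real^'p) \<times> (real^'p) \<times> (real^'p)" where
  "state k \<omega> = (x (Suc k) \<omega>, x k \<omega>, w k \<omega>)"

lemma state_eq_run:
  assumes "\<omega> \<in> space M"
  shows "state k \<omega> = run (history (\<lambda>k \<omega>. (Z k \<omega>, B k \<omega>)) k \<omega>)"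
proof (induction k)
  case 0
  show ?case
    using iterate[OF assms, of 0] iterate_0[OF assms] snapshot_0[OF assms] estimator_0[OF assms]
    by (simp add: state_def theta_def gam_def)
next
  case (Suc k)
  have "state (Suc k) \<omega> = advance (Suc k) (state k \<omega>) (Z (Suc k) \<omega>, B (Suc k) \<omega>)"
    using iterate[OF assms, of "Suc k"] snapshot[OF _ assms, of "Suc k"] estimator[OF _ assms, of "Suc k"]
    by (simp add: state_def estimate_def)
  then show ?case using Suc.IH by simp
qed

lemma finite_draw_pmf: "finite (set_pmf draw_pmf)"
  and finite_batch_pmf: "finite (set_pmf (replicate_pmf b (pmf_of_set {1..n})))"
proof -
  have "finite (set_pmf (pmf_of_set {1..n}))" using n_pos by (subst set_pmf_of_set) auto
  then show "finite (set_pmf (replicate_pmf b (pmf_of_set {1..n})))"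
    by (rule finite_set_replicate_pmf)
  then show "finite (set_pmf draw_pmf)" by (simp add: draw_pmf_def)
qed

text \<open>Only finitely many histories of a given length have positive probability, so every function
  of the state is integrable.\<close>
lemma expectation_state:
  fixes f :: "_ \<Rightarrow> real"
  shows "integrable M (\<lambda>\<omega>. f (state k \<omega>))"
    and "expectation (\<lambda>\<omega>. f (state k \<omega>)) = measure_pmf.expectation (replicate_pmf k draw_pmf) (\<lambda>h. f (run h))"
proof -
  let ?h = "history (\<lambda>k \<omega>. (Z k \<omega>, B k \<omega>)) k"
  note law = history_law[OF draws_indep draws_distr[folded draw_pmf_def], of k]
  have "integrable (measure_pmf (replicate_pmf k draw_pmf)) (\<lambda>h. f (run h))"
    by (intro integrable_measure_pmf_finite finite_set_replicate_pmf finite_draw_pmf)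
  then have "integrable (distr M (count_space UNIV) ?h) (\<lambda>h. f (run h))"
    by (simp only: law(2))
  then have "integrable M (\<lambda>\<omega>. f (run (?h \<omega>)))"
    by (subst (asm) integrable_distr_eq[OF law(1)]) auto
  then show "integrable M (\<lambda>\<omega>. f (state k \<omega>))"
    by (subst Bochner_Integration.integrable_cong[OF refl]) (auto simp: state_eq_run)
  have "expectation (\<lambda>\<omega>. f (state k \<omega>)) = expectation (\<lambda>\<omega>. f (run (?h \<omega>)))"
    by (rule Bochner_Integration.integral_cong) (auto simp: state_eq_run)
  also have "\<dots> = integral\<^sup>L (distr M (count_space UNIV) ?h) (\<lambda>h. f (run h))"
    by (subst integral_distr[OF law(1)]) auto
  finally show "expectation (\<lambda>\<omega>. f (state k \<omega>)) = measure_pmf.expectation (replicate_pmf k draw_pmf) (\<lambda>h. f (run h))"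
    by (simp only: law(2))
qed

text \<open>A one-step inequality that holds in every state, with the mean taken over a single fresh
  draw, passes to the unconditional means.\<close>
lemma expectation_state_Suc_le:
  fixes f h :: "_ \<Rightarrow> real"
  assumes "\<And>s. measure_pmf.expectation draw_pmf (\<lambda>d. f (advance (Suc k) s d)) \<le> h s"
  shows "expectation (\<lambda>\<omega>. f (state (Suc k) \<omega>)) \<le> expectation (\<lambda>\<omega>. h (state k \<omega>))"
proof -
  have "expectation (\<lambda>\<omega>. f (state (Suc k) \<omega>)) =
     measure_pmf.expectation (replicate_pmf k draw_pmf)
       (\<lambda>ds. measure_pmf.expectation draw_pmf (\<lambda>d. f (run (d # ds))))"
    unfolding expectation_state(2) by (rule expectation_replicate_pmf_Suc_last[OF finite_draw_pmf])
  also have "\<dots> \<le> measure_pmf.expectation (replicate_pmf k draw_pmf) (\<lambda>ds. h (run ds))"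
  proof (rule expectation_mono_finite)
    fix ds assume "ds \<in> set_pmf (replicate_pmf k draw_pmf)"
    then have "length ds = k" by (simp add: set_replicate_pmf)
    then show "measure_pmf.expectation draw_pmf (\<lambda>d. f (run (d # ds))) \<le> h (run ds)"
      using assms[of "run ds"] by simp
  qed (rule finite_set_replicate_pmf[OF finite_draw_pmf])
  also have "\<dots> = expectation (\<lambda>\<omega>. h (state k \<omega>))"
    by (rule expectation_state(2)[symmetric])
  finally show ?thesis .
qed

lemma expectation_svrg_evals:
  "expectation (\<lambda>\<omega>. real (svrg_evals n b Z (Suc K) \<omega>)) = real n + real K * (3 * real b + q * real n)"
proof -
  have Z: "integrable M (\<lambda>\<omega>. if Z k \<omega> then real n else 0)"
    "expectation (\<lambda>\<omega>. if Z k \<omega> then real n else 0) = q * real n" if "k \<ge> 1" for k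
  proof -
    let ?f = "\<lambda>d :: bool \<times> nat list. if fst d then real n else 0"
    have m: "(\<lambda>\<omega>. (Z k \<omega>, B k \<omega>)) \<in> measurable M (count_space UNIV)"
      using draws_indep that by (auto simp: indep_vars_def)
    note law = draws_distr[OF that, folded draw_pmf_def]
    have "integrable (distr M (count_space UNIV) (\<lambda>\<omega>. (Z k \<omega>, B k \<omega>))) ?f"
      unfolding law by (intro integrable_measure_pmf_finite finite_draw_pmf)
    then show "integrable M (\<lambda>\<omega>. if Z k \<omega> then real n else 0)"
      by (subst (asm) integrable_distr_eq[OF m]) auto
    have "expectation (\<lambda>\<omega>. ?f (Z k \<omega>, B k \<omega>)) = measure_pmf.expectation draw_pmf ?f"
      unfolding law[symmetric] by (subst integral_distr[OF m]) auto
    also have "\<dots> = q * real n"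
      unfolding draw_pmf_def using q_range finite_batch_pmf
      by (subst expectation_pair_pmf_finite) auto
    finally show "expectation (\<lambda>\<omega>. if Z k \<omega> then real n else 0) = q * real n" by simp
  qed
  have e: "real (svrg_evals n b Z (Suc K) \<omega>) = real n + (\<Sum>k=1..K. 3 * real b + (if Z k \<omega> then real n else 0))" for \<omega>
    unfolding svrg_evals_def by (induction K) auto
  have "expectation (\<lambda>\<omega>. \<Sum>k=1..K. 3 * real b + (if Z k \<omega> then real n else 0)) = (\<Sum>k=1..K. 3 * real b + q * real n)"
    by (subst Bochner_Integration.integral_sum)
       (auto intro!: sum.cong simp: Z prob_space Bochner_Integration.integral_add)
  moreover have "integrable M (\<lambda>\<omega>. \<Sum>k=1..K. 3 * real b + (if Z k \<omega> then real n else 0))"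
    by (intro Bochner_Integration.integrable_sum Bochner_Integration.integrable_add Z) auto
  ultimately show ?thesis
    unfolding e by (subst Bochner_Integration.integral_add) (auto simp: prob_space)
qed

end

section \<open>One step of the method in mean\<close>
text \<open>The sum of all terms that sampling adds to one step against what cocoercivity gains, divided
  by \<open>\<beta>\<^sup>2\<close>. \<open>U\<close> is the mean square of the change between consecutive iterates and \<open>W\<close> the
  gap to the snapshot; \<open>\<omega>\<close> bounds the mean of the next gap. The weight \<open>\<phi>\<close> is chosen
  so that the contraction factor \<open>1 - q / 2\<close> pays for the noise \<open>24 \<omega>\<close> with something to
  spare, at a price of \<open>108 U / q\<^sup>2\<close>. Dividing by \<open>b\<close> turns this price into \<open>108 U / \<tau>\<close>,
  which is why the step size has to depend on \<open>\<tau> = b q\<^sup>2\<close>.\<close>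
lemma noise_budget:
  fixes q \<tau> b m U W :: real
  assumes q: "0 < q" "q < 1" and \<tau>: "\<tau> = b * q\<^sup>2" "\<tau> \<ge> 1" and m: "m \<ge> 1" and UW: "U \<ge> 0" "W \<ge> 0"
  defines "\<phi> \<equiv> 27 * (2 - q) / q" and "\<omega> \<equiv> (1 - q / 2) * W + 2 / q * U"
  shows "8 * m\<^sup>2 * U / b + (24 + \<phi>) * \<omega> / b - 3/16 * (m + 4) * m * (1 + 128 / \<tau>) * U
    \<le> \<phi> * W / b - 3/2 * W / b - 3/16 * m\<^sup>2 * U"
proof -
  have b: "b > 0" using \<tau> q by (metis less_le_trans zero_less_mult_pos2 zero_less_one zero_less_power)
  have "(24 + \<phi>) * (1 - q / 2) = \<phi> - 3 + 3/2 * q"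
    unfolding \<phi>_def using q by (simp add: field_simps power2_eq_square)
  then have "(24 + \<phi>) * (1 - q / 2) \<le> \<phi> - 3/2" using q by simp
  from mult_right_mono[OF this UW(2)]
  have 1: "(24 + \<phi>) * (1 - q / 2) * W \<le> \<phi> * W - 3/2 * W" by (simp add: algebra_simps)
  have "(24 + \<phi>) * (2 / q) = 108 / q\<^sup>2 - 6 / q"
    unfolding \<phi>_def using q by (simp add: field_simps power2_eq_square)
  then have "(24 + \<phi>) * (2 / q) \<le> 108 / q\<^sup>2" using q by simp
  from mult_right_mono[OF this UW(1)]
  have 2: "(24 + \<phi>) * (2 / q) * U \<le> 108 / q\<^sup>2 * U" .
  have "(24 + \<phi>) * \<omega> \<le> \<phi> * W - 3/2 * W + 108 / q\<^sup>2 * U"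
    using 1 2 unfolding \<omega>_def by (simp add: algebra_simps)
  then have "(24 + \<phi>) * \<omega> / b \<le> (\<phi> * W - 3/2 * W + 108 / q\<^sup>2 * U) / b"
    using b by (intro divide_right_mono) auto
  also have "\<dots> = \<phi> * W / b - 3/2 * W / b + 108 / \<tau> * U"
    unfolding \<tau>(1) using b q by (simp add: add_divide_distrib diff_divide_distrib)
  finally have 3: "(24 + \<phi>) * \<omega> / b \<le> \<phi> * W / b - 3/2 * W / b + 108 / \<tau> * U" .
  have "\<tau> \<le> b" using b q \<tau>(1) by (simp add: power_le_one mult_left_le)
  then have "8 * m\<^sup>2 * U / b \<le> 8 * m\<^sup>2 * U / \<tau>"
    using \<tau>(2) UW by (intro divide_left_mono) auto
  then have 4: "8 * m\<^sup>2 * U / b \<le> 8 * m\<^sup>2 / \<tau> * U" by simp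
  \<comment> \<open>The tightest case is \<open>m = 1\<close>: \<open>116\<close> against \<open>3/16\<close> times \<open>128\<close> times \<open>5\<close>, which is \<open>120\<close>.\<close>
  have "8 * m\<^sup>2 + 108 \<le> 24 * (m + 4) * m"
  proof -
    have "1 \<le> m * m" using mult_mono[of 1 m 1 m] m by simp
    then show ?thesis using m by (simp add: power2_eq_square algebra_simps)
  qed
  then have "(8 * m\<^sup>2 + 108) / \<tau> \<le> 24 * (m + 4) * m / \<tau>"
    using \<tau>(2) by (intro divide_right_mono) auto
  moreover have "3/16 * m\<^sup>2 \<le> 3/16 * (m + 4) * m" using m by (simp add: power2_eq_square algebra_simps)
  moreover have "3/16 * (m + 4) * m * (1 + 128 / \<tau>) = 3/16 * (m + 4) * m + 24 * (m + 4) * m / \<tau>"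
    by (simp add: distrib_left)
  ultimately have "8 * m\<^sup>2 / \<tau> + 108 / \<tau> - 3/16 * (m + 4) * m * (1 + 128 / \<tau>) \<le> - (3/16 * m\<^sup>2)"
    by (simp add: add_divide_distrib)
  from mult_right_mono[OF this UW(1)]
  have "8 * m\<^sup>2 / \<tau> * U + 108 / \<tau> * U - 3/16 * (m + 4) * m * (1 + 128 / \<tau>) * U \<le> - (3/16 * m\<^sup>2 * U)"
    by (simp add: algebra_simps)
  then show ?thesis using 3 4 by argo
qed

context vfkm_svrg
begin

lemma b_pos: "b \<ge> 1"
  using bq_range by (cases b) auto

lemma \<beta>_facts:
  shows \<beta>_pos: "\<beta> > 0"
    and \<beta>_over_L: "\<beta> / L = \<beta>\<^sup>2 * (2 + 128 / (real b * q\<^sup>2))"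
    and \<beta>_ge: "1 / (130 * L) \<le> \<beta>"
    and \<beta>_le: "\<beta> \<le> 1 / (6 * L)"
proof -
  define \<tau> where "\<tau> = real b * q\<^sup>2"
  have t: "1 \<le> \<tau>" "\<tau> \<le> 32" using bq_range by (auto simp: \<tau>_def)
  have b: "\<beta> = \<tau> / (2 * L * (\<tau> + 64))" by (simp add: beta_def \<tau>_def)
  show "\<beta> > 0" using t L_pos by (simp add: b)
  show "\<beta> / L = \<beta>\<^sup>2 * (2 + 128 / (real b * q\<^sup>2))"
    unfolding \<tau>_def[symmetric] b using t L_pos by (simp add: divide_simps power2_eq_square)
  show "1 / (130 * L) \<le> \<beta>" "\<beta> \<le> 1 / (6 * L)"
    unfolding b using t L_pos by (auto simp: divide_simps)
qed

text \<open>The older iterate is used because its gap is known before the coin of the current step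
  is tossed.\<close>
fun snapshot_gap :: "(real^'p) \<times> (real^'p) \<times> (real^'p) \<Rightarrow> real" where
  "snapshot_gap (xc, xp, u) = mean_sq n (\<lambda>i. G i xp - G i u)"

fun variation :: "(real^'p) \<times> (real^'p) \<times> (real^'p) \<Rightarrow> real" where
  "variation (xc, xp, u) = mean_sq n (\<lambda>i. G i xc - G i xp)"

fun velocity :: "nat \<Rightarrow> (real^'p) \<times> (real^'p) \<times> (real^'p) \<Rightarrow> real^'p" where
  "velocity k (xc, xp, u) = vel (real k) (xc - xp) (\<beta> *\<^sub>R g xp)"

text \<open>The deviation of the estimator from \<open>S\<close>, scaled to the displacement of the next iterate.\<close>
definition sampling_error :: "nat \<Rightarrow> real^'p \<Rightarrow> real^'p \<Rightarrow> real^'p \<Rightarrow> nat list \<Rightarrow> real^'p" where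
  "sampling_error k xc xp u bs = eta \<beta> k *\<^sub>R (estimate k xc xp u bs - (g xc - gam k *\<^sub>R g xp))"

lemma advance_eq:
  "advance k (xc, xp, u) (z, bs) =
     (xc + (step (real k) (velocity k (xc, xp, u)) (\<beta> *\<^sub>R g xc) - sampling_error k xc xp (if z then xp else u) bs),
      xc, if z then xp else u)"
proof -
  have 1: "eta \<beta> k * gam k = 2 * \<beta> * real k / (real k + 5)"
    by (simp add: eta_def gam_def)
  have "step (real k) (velocity k (xc, xp, u)) (\<beta> *\<^sub>R g xc)
      = theta k *\<^sub>R (xc - xp) - eta \<beta> k *\<^sub>R g xc + (eta \<beta> k * gam k) *\<^sub>R g xp"
    unfolding 1 by (simp add: step_def vel_def theta_def eta_def algebra_simps add_divide_distrib)
  then show ?thesis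
    by (simp add: sampling_error_def algebra_simps)
qed

text \<open>The estimator averages \<open>G\<^sub>i xc - gam k G\<^sub>i xp - (1 - gam k) G\<^sub>i u\<close> over the mini-batch.
  Multiplied by \<open>k + 3\<close> this is \<open>k (G\<^sub>i xc - G\<^sub>i xp) + 3 (G\<^sub>i xc - G\<^sub>i u)\<close>: only the change
  between iterates carries the factor \<open>k\<close>, the gap to the snapshot does not.\<close>
lemma sampling_error_moments:
  fixes k xc xp u
  defines "P \<equiv> replicate_pmf b (pmf_of_set {1..n})"
  shows "measure_pmf.expectation P (\<lambda>bs. l \<bullet> sampling_error k xc xp u bs) = 0"
    and "measure_pmf.expectation P (\<lambda>bs. (norm (sampling_error k xc xp u bs))\<^sup>2)
      \<le> 4 * \<beta>\<^sup>2 / (real b * (real k + 5)\<^sup>2) *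
        (4 * (real k)\<^sup>2 * mean_sq n (\<lambda>i. G i xc - G i xp) + 12 * mean_sq n (\<lambda>i. G i xc - G i u))"
proof -
  define h where "h = (\<lambda>i. G i xc - gam k *\<^sub>R G i xp - (1 - gam k) *\<^sub>R G i u)"
  have list: "(\<Sum>i\<leftarrow>bs. h i) = (\<Sum>i\<leftarrow>bs. G i xc) - gam k *\<^sub>R (\<Sum>i\<leftarrow>bs. G i xp) - (1 - gam k) *\<^sub>R (\<Sum>i\<leftarrow>bs. G i u)" for bs
    by (induction bs) (auto simp: h_def algebra_simps)
  have all: "(\<Sum>i=1..n. h i) = (\<Sum>i=1..n. G i xc) - gam k *\<^sub>R (\<Sum>i=1..n. G i xp) - (1 - gam k) *\<^sub>R (\<Sum>i=1..n. G i u)"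
    by (simp only: h_def sum_subtractf scaleR_sum_right)
  have err: "sampling_error k xc xp u bs
     = eta \<beta> k *\<^sub>R ((1 / real b) *\<^sub>R (\<Sum>i\<leftarrow>bs. h i) - (1 / real n) *\<^sub>R (\<Sum>i=1..n. h i))" for bs
    unfolding list all sampling_error_def estimate_def batch_avg_def finite_avg_def
    by (simp add: algebra_simps add_divide_distrib diff_divide_distrib)
  note moments = minibatch_error[OF n_pos b_pos, where f = h]
  show "measure_pmf.expectation P (\<lambda>bs. l \<bullet> sampling_error k xc xp u bs) = 0"
    unfolding err inner_scaleR_right P_def using moments(1) by simp
  have "(real k + 3) *\<^sub>R h i = real k *\<^sub>R (G i xc - G i xp) + 3 *\<^sub>R (G i xc - G i u)" for i
  proof -
    have "(real k + 3) * gam k = real k" "(real k + 3) * (1 - gam k) = 3"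
      by (simp_all add: gam_def field_simps)
    moreover have "(real k + 3) *\<^sub>R h i = (real k + 3) *\<^sub>R G i xc - ((real k + 3) * gam k) *\<^sub>R G i xp
        - ((real k + 3) * (1 - gam k)) *\<^sub>R G i u"
      by (simp add: h_def scaleR_diff_right)
    ultimately show ?thesis by (simp add: algebra_simps)
  qed
  then have "(real k + 3)\<^sup>2 * mean_sq n h = mean_sq n (\<lambda>i. real k *\<^sub>R (G i xc - G i xp) + 3 *\<^sub>R (G i xc - G i u))"
    by (simp flip: mean_sq_scale)
  also have "\<dots> \<le> (1 + 3) * mean_sq n (\<lambda>i. real k *\<^sub>R (G i xc - G i xp))
      + (1 + 1 / 3) * mean_sq n (\<lambda>i. 3 *\<^sub>R (G i xc - G i u))"
    \<comment> \<open>The split with ratio 3 keeps the coefficient 12 of the gap small. The gap is expensive: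
    its price is later of order \<open>1 / q\<^sup>2\<close>.\<close>
    by (rule mean_sq_add_le) simp
  also have "\<dots> = 4 * (real k)\<^sup>2 * mean_sq n (\<lambda>i. G i xc - G i xp) + 12 * mean_sq n (\<lambda>i. G i xc - G i u)"
    by (simp add: mean_sq_scale)
  finally have h: "(real k + 3)\<^sup>2 * mean_sq n h \<le> \<dots>" .
  have "measure_pmf.expectation P (\<lambda>bs. (norm (sampling_error k xc xp u bs))\<^sup>2) \<le> (eta \<beta> k)\<^sup>2 * (mean_sq n h / real b)"
    unfolding err norm_scaleR power_mult_distrib P_def using mult_left_mono[OF moments(2), of "(eta \<beta> k)\<^sup>2"] by simp
  also have "\<dots> = 4 * \<beta>\<^sup>2 / (real b * (real k + 5)\<^sup>2) * ((real k + 3)\<^sup>2 * mean_sq n h)"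
    by (simp add: eta_def power_divide power_mult_distrib mult_ac)
  also have "\<dots> \<le> 4 * \<beta>\<^sup>2 / (real b * (real k + 5)\<^sup>2) *
        (4 * (real k)\<^sup>2 * mean_sq n (\<lambda>i. G i xc - G i xp) + 12 * mean_sq n (\<lambda>i. G i xc - G i u))"
    by (rule mult_left_mono[OF h]) simp
  finally show "measure_pmf.expectation P (\<lambda>bs. (norm (sampling_error k xc xp u bs))\<^sup>2) \<le> \<dots>" .
qed

text \<open>Bound on the mean of the next snapshot gap, from Young's inequality with ratio
  \<open>2 / q\<close>.\<close>
definition gap_bound :: "(real^'p) \<times> (real^'p) \<times> (real^'p) \<Rightarrow> real" where
  "gap_bound s = (1 - q / 2) * snapshot_gap s + 2 / q * variation s"

lemma gap_nonneg: "snapshot_gap s \<ge> 0" "variation s \<ge> 0"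
  by (cases s; simp add: mean_sq_nonneg)+

lemma snapshot_gap_expected:
  "q * mean_sq n (\<lambda>i. G i xc - G i xp) + (1 - q) * mean_sq n (\<lambda>i. G i xc - G i u) \<le> gap_bound (xc, xp, u)"
proof -
  define U W where "U = mean_sq n (\<lambda>i. G i xc - G i xp)" and "W = mean_sq n (\<lambda>i. G i xp - G i u)"
  have nn: "U \<ge> 0" "W \<ge> 0" by (auto simp: U_def W_def mean_sq_nonneg)
  have "mean_sq n (\<lambda>i. G i xc - G i u) \<le> (1 + 2 / q) * U + (1 + q / 2) * W"
    using mean_sq_add_le[of "2 / q" n "\<lambda>i. G i xc - G i xp" "\<lambda>i. G i xp - G i u"] q_range
    by (simp add: U_def W_def)
  then have "(1 - q) * mean_sq n (\<lambda>i. G i xc - G i u) \<le> (1 - q) * ((1 + 2 / q) * U + (1 + q / 2) * W)"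
    using q_range by (intro mult_left_mono) auto
  also have "\<dots> = (2 / q - 1 - q) * U + (1 - q / 2 - q\<^sup>2 / 2) * W"
    using q_range by (simp add: field_simps power2_eq_square)
  also have "\<dots> \<le> (2 / q - q) * U + (1 - q / 2) * W"
    using nn by (intro add_mono mult_right_mono) auto
  finally show ?thesis
    by (simp add: gap_bound_def U_def W_def algebra_simps)
qed

text \<open>The energy, the squared velocity and the corrector are all quadratic in the perturbation of
  the next iterate, so that this lemma covers them at once: the linear part has mean zero, and
  the square contributes the variance. The snapshot gap is averaged over the coin as well.\<close>
lemma advance_expectation_le:
  fixes F :: "real^'p \<Rightarrow> real"
  assumes quadratic: "\<And>d. F (xc + (step (real k) (velocity k (xc, xp, u)) (\<beta> *\<^sub>R g xc) - d)) = c + l \<bullet> d + r * (norm d)\<^sup>2"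
    and r: "r \<ge> 0" "a \<ge> 0"
  defines "K \<equiv> r * (4 * \<beta>\<^sup>2 / (real b * (real k + 5)\<^sup>2))"
  shows "measure_pmf.expectation draw_pmf (\<lambda>d. F (fst (advance k (xc, xp, u) d)) + a * snapshot_gap (advance k (xc, xp, u) d))
    \<le> c + 4 * K * (real k)\<^sup>2 * variation (xc, xp, u) + (12 * K + a) * gap_bound (xc, xp, u)"
proof -
  let ?P = "replicate_pmf b (pmf_of_set {1..n})"
  let ?f = "\<lambda>d. F (fst (advance k (xc, xp, u) d)) + a * snapshot_gap (advance k (xc, xp, u) d)"
  define U where "U = mean_sq n (\<lambda>i. G i xc - G i xp)"
  define V where "V = (\<lambda>z. mean_sq n (\<lambda>i. G i xc - G i (if z then xp else u)))"
  have K: "K \<ge> 0" using r by (simp add: K_def)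
  have int: "integrable (measure_pmf ?P) h" for h :: "_ \<Rightarrow> real"
    by (rule integrable_measure_pmf_finite[OF finite_batch_pmf])
  have inner: "measure_pmf.expectation ?P (\<lambda>bs. ?f (z, bs)) \<le> c + 4 * K * (real k)\<^sup>2 * U + (12 * K + a) * V z" for z
  proof -
    let ?e = "sampling_error k xc xp (if z then xp else u)"
    have "?f (z, bs) = (c + a * V z) + (l \<bullet> ?e bs + r * (norm (?e bs))\<^sup>2)" for bs
      unfolding advance_eq by (simp only: fst_conv quadratic snapshot_gap.simps V_def)
    then have "measure_pmf.expectation ?P (\<lambda>bs. ?f (z, bs))
        = (c + a * V z) + (measure_pmf.expectation ?P (\<lambda>bs. l \<bullet> ?e bs) + r * measure_pmf.expectation ?P (\<lambda>bs. (norm (?e bs))\<^sup>2))"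
      by (simp only: Bochner_Integration.integral_add[OF int int] integral_mult_right_zero) simp
    also have "\<dots> \<le> (c + a * V z) + (0 + r * (4 * \<beta>\<^sup>2 / (real b * (real k + 5)\<^sup>2) * (4 * (real k)\<^sup>2 * U + 12 * V z)))"
      unfolding sampling_error_moments(1) U_def V_def
      by (intro add_left_mono mult_left_mono sampling_error_moments(2) r)
    also have "\<dots> = c + 4 * K * (real k)\<^sup>2 * U + (12 * K + a) * V z"
      unfolding K_def by argo
    finally show ?thesis .
  qed
  have "measure_pmf.expectation draw_pmf ?f
      = measure_pmf.expectation (bernoulli_pmf q) (\<lambda>z. measure_pmf.expectation ?P (\<lambda>bs. ?f (z, bs)))"
    unfolding draw_pmf_def by (rule expectation_pair_pmf_finite[OF _ finite_batch_pmf]) simp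
  also have "\<dots> \<le> measure_pmf.expectation (bernoulli_pmf q) (\<lambda>z. c + 4 * K * (real k)\<^sup>2 * U + (12 * K + a) * V z)"
    by (rule expectation_mono_finite[OF _ inner]) simp
  also have "\<dots> = c + 4 * K * (real k)\<^sup>2 * U + (12 * K + a) * (q * V True + (1 - q) * V False)"
    using q_range by (simp add: algebra_simps)
  also have "\<dots> \<le> c + 4 * K * (real k)\<^sup>2 * U + (12 * K + a) * gap_bound (xc, xp, u)"
    using snapshot_gap_expected[of xc xp u] K r by (intro add_left_mono mult_left_mono) (auto simp: V_def)
  finally show ?thesis by (simp add: U_def)
qed

definition gap_weight :: real where
  "gap_weight = 27 * (2 - q) / q * (\<beta>\<^sup>2 / real b)"

text \<open>The weighted snapshot gap remembers how much variance the current snapshot can still cause.\<close>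
definition potential :: "real^'p \<Rightarrow> nat \<Rightarrow> (real^'p) \<times> (real^'p) \<times> (real^'p) \<Rightarrow> real" where
  "potential xs k = (\<lambda>(xc, xp, u).
     energy (real k) (xc - xs) (velocity k (xc, xp, u)) (\<beta> *\<^sub>R g xp) + gap_weight * snapshot_gap (xc, xp, u))"

lemma potential_simp [simp]: "potential xs k (xc, xp, u) =
     energy (real k) (xc - xs) (velocity k (xc, xp, u)) (\<beta> *\<^sub>R g xp) + gap_weight * snapshot_gap (xc, xp, u)"
  by (simp add: potential_def)

lemma gap_weight_nonneg: "gap_weight \<ge> 0"
  using q_range by (simp add: gap_weight_def)

text \<open>Cocoercivity against a zero, with \<open>6 \<beta> \<le> 1 / L\<close>.\<close>
lemma operator_inner_ge:
  assumes "xs \<in> zer g"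
  shows "6 * (norm (\<beta> *\<^sub>R g y))\<^sup>2 \<le> (y - xs) \<bullet> (\<beta> *\<^sub>R g y)"
proof -
  have "g xs = 0" using assms by (simp add: zer_def)
  then have "(1 / L) * (norm (g y))\<^sup>2 \<le> (1 / L) * mean_sq n (\<lambda>i. G i y - G i xs)"
    using norm_finite_avg_diff_le[OF n_pos, of G y xs] L_pos by (intro mult_left_mono) auto
  also have "\<dots> \<le> g y \<bullet> (y - xs)"
    using avg_cocoerciveD[OF cocoercive, of y xs] \<open>g xs = 0\<close> by simp
  finally have 1: "\<beta> * ((1 / L) * (norm (g y))\<^sup>2) \<le> \<beta> * (g y \<bullet> (y - xs))"
    using \<beta>_pos by (intro mult_left_mono) auto
  have "6 * \<beta> * (\<beta> * (norm (g y))\<^sup>2) \<le> 1 / L * (\<beta> * (norm (g y))\<^sup>2)"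
    using \<beta>_le \<beta>_pos L_pos by (intro mult_right_mono) (auto simp: field_simps)
  also have "\<dots> \<le> \<beta> * (g y \<bullet> (y - xs))" using 1 by simp
  finally show ?thesis
    by (simp add: power_mult_distrib power2_eq_square inner_commute mult_ac)
qed

text \<open>Cocoercivity between consecutive iterates. As \<open>\<beta> / L = \<beta>\<^sup>2 (2 + 128 / (b q\<^sup>2))\<close>, a multiple
  \<open>128 / (b q\<^sup>2)\<close> is left to compensate for the noise.\<close>
lemma increment_inner_ge:
  "real k * \<beta>\<^sup>2 * (1 + 128 / (real b * q\<^sup>2)) * variation (xc, xp, u)
    \<le> (velocity k (xc, xp, u) - (2 * real k) *\<^sub>R (\<beta> *\<^sub>R g xp)) \<bullet> (\<beta> *\<^sub>R g xc - \<beta> *\<^sub>R g xp)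
      - real k * (norm (\<beta> *\<^sub>R g xc - \<beta> *\<^sub>R g xp))\<^sup>2"
proof -
  let ?U = "mean_sq n (\<lambda>i. G i xc - G i xp)"
  have "\<beta> * ((1 / L) * ?U) \<le> \<beta> * ((g xc - g xp) \<bullet> (xc - xp))"
    using avg_cocoerciveD[OF cocoercive, of xc xp] \<beta>_pos by (intro mult_left_mono) auto
  then have "\<beta>\<^sup>2 * (2 + 128 / (real b * q\<^sup>2)) * ?U \<le> (xc - xp) \<bullet> (\<beta> *\<^sub>R (g xc - g xp))"
    unfolding \<beta>_over_L[symmetric] by (simp add: inner_commute)
  moreover have "(norm (\<beta> *\<^sub>R (g xc - g xp)))\<^sup>2 \<le> \<beta>\<^sup>2 * ?U"
    using norm_finite_avg_diff_le[OF n_pos, of G xc xp] by (simp add: power_mult_distrib mult_left_mono)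
  ultimately have le: "\<beta>\<^sup>2 * (1 + 128 / (real b * q\<^sup>2)) * ?U
      \<le> (xc - xp) \<bullet> (\<beta> *\<^sub>R (g xc - g xp)) - (norm (\<beta> *\<^sub>R (g xc - g xp)))\<^sup>2"
    by (simp add: algebra_simps)
  have "velocity k (xc, xp, u) - (2 * real k) *\<^sub>R (\<beta> *\<^sub>R g xp) = real k *\<^sub>R (xc - xp)"
    by (simp add: vel_def algebra_simps)
  then show ?thesis
    using mult_left_mono[OF le, of "real k"]
    by (simp only: inner_scaleR_left variation.simps scaleR_diff_right[of \<beta>, symmetric]) (simp add: right_diff_distrib mult.assoc)
qed

lemma potential_advance:
  assumes xs: "xs \<in> zer g" and k: "k \<ge> 1"
  shows "measure_pmf.expectation draw_pmf (\<lambda>d. potential xs (Suc k) (advance k (xc, xp, u) d))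
    \<le> potential xs k (xc, xp, u)
      - (1/5 * ((norm (velocity k (xc, xp, u)))\<^sup>2 / (real k + 5) + (real k + 5) * (norm (\<beta> *\<^sub>R g xc))\<^sup>2)
         + 3/16 * \<beta>\<^sup>2 * ((real k)\<^sup>2 * variation (xc, xp, u))
         + 3/2 * (\<beta>\<^sup>2 / real b) * snapshot_gap (xc, xp, u))"
proof -
  define s v c e where "s = (xc, xp, u)" and "v = velocity k s" and "c = \<beta> *\<^sub>R g xc" and "e = \<beta> *\<^sub>R g xp"
  define m where "m = real k"
  have m: "m \<ge> 1" using k by (simp add: m_def)
  define F where "F = (\<lambda>y. energy (m + 1) (y - xs) (vel (m + 1) (y - xc) c) c)"
  define r where "r = (m + 3)\<^sup>2 / 2 + 2"
  obtain l where l: "energy (m + 1) ((xc - xs) + (step m v c - d)) (vel (m + 1) (step m v c - d) c) c =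
     energy (m + 1) ((xc - xs) + step m v c) (vel (m + 1) (step m v c) c) c + l \<bullet> d + ((m + 1 + 2)\<^sup>2 / 2 + 2) * (norm d)\<^sup>2" for d
    using energy_perturb by blast
  define c0 where "c0 = energy (m + 1) ((xc - xs) + step m v c) (vel (m + 1) (step m v c) c) c"
  have F: "F (xc + (step m v c - d)) = c0 + l \<bullet> d + r * (norm d)\<^sup>2" for d
  proof -
    have "xc + z - xs = (xc - xs) + z" "xc + z - xc = z" "m + 1 + 2 = m + 3" for z by auto
    then show ?thesis using l[of d] by (simp only: F_def c0_def r_def)
  qed
  define K where "K = r * (4 * \<beta>\<^sup>2 / (real b * (m + 5)\<^sup>2))"
  define U W where "U = variation s" and "W = snapshot_gap s"
  have nn: "U \<ge> 0" "W \<ge> 0" by (auto simp: U_def W_def gap_nonneg)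
  have gb: "gap_bound s = (1 - q / 2) * W + 2 / q * U" by (simp add: gap_bound_def U_def W_def)
  have gb_nn: "gap_bound s \<ge> 0" unfolding gb using nn q_range by simp
  have K: "K \<le> 2 * (\<beta>\<^sup>2 / real b)"
  proof -
    have "4 * r \<le> 2 * (m + 5)\<^sup>2"
      using m by (simp add: r_def power2_eq_square algebra_simps)
    then have "4 * r / (m + 5)\<^sup>2 \<le> 2" using m by (simp add: divide_simps)
    then have "4 * r / (m + 5)\<^sup>2 * (\<beta>\<^sup>2 / real b) \<le> 2 * (\<beta>\<^sup>2 / real b)"
      by (rule mult_right_mono) simp
    then show ?thesis by (simp add: K_def mult_ac)
  qed
  have "potential xs (Suc k) (advance k s d) = F (fst (advance k s d)) + gap_weight * snapshot_gap (advance k s d)" for d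
    by (cases d) (simp add: s_def F_def c_def m_def add.commute[of 1])
  then have "measure_pmf.expectation draw_pmf (\<lambda>d. potential xs (Suc k) (advance k s d))
    \<le> c0 + 4 * K * m\<^sup>2 * U + (12 * K + gap_weight) * gap_bound s"
    using advance_expectation_le[of F xc k xp u, OF F[unfolded m_def v_def s_def c_def] _ gap_weight_nonneg]
    by (simp only: s_def m_def K_def U_def) (simp add: r_def)
  also have "\<dots> \<le> c0 + 4 * (2 * (\<beta>\<^sup>2 / real b)) * m\<^sup>2 * U + (12 * (2 * (\<beta>\<^sup>2 / real b)) + gap_weight) * gap_bound s"
    using K nn gb_nn by (intro add_mono mult_right_mono mult_left_mono order_refl) auto
  finally have upper: "measure_pmf.expectation draw_pmf (\<lambda>d. potential xs (Suc k) (advance k s d)) \<le> \<dots>" .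
  have descent: "c0 \<le> energy m (xc - xs) v e - 1/5 * ((norm v)\<^sup>2 / (m + 5) + (m + 5) * (norm c)\<^sup>2)
    - 3/16 * (m + 4) * ((v - (2 * m) *\<^sub>R e) \<bullet> (c - e) - m * (norm (c - e))\<^sup>2)"
    unfolding c0_def using m operator_inner_ge[OF xs, of xc] by (intro energy_descent) (auto simp: c_def)
  have gain: "3/16 * (m + 4) * (m * \<beta>\<^sup>2 * (1 + 128 / (real b * q\<^sup>2)) * U)
      \<le> 3/16 * (m + 4) * ((v - (2 * m) *\<^sub>R e) \<bullet> (c - e) - m * (norm (c - e))\<^sup>2)"
    using m increment_inner_ge[of k xc xp u]
    by (intro mult_left_mono) (simp_all only: m_def v_def c_def e_def s_def U_def, simp)
  have 1: "measure_pmf.expectation draw_pmf (\<lambda>d. potential xs (Suc k) (advance k s d))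
    \<le> energy m (xc - xs) v e - 1/5 * ((norm v)\<^sup>2 / (m + 5) + (m + 5) * (norm c)\<^sup>2)
      - 3/16 * (m + 4) * (m * \<beta>\<^sup>2 * (1 + 128 / (real b * q\<^sup>2)) * U)
      + 4 * (2 * (\<beta>\<^sup>2 / real b)) * m\<^sup>2 * U + (12 * (2 * (\<beta>\<^sup>2 / real b)) + gap_weight) * gap_bound s"
    using upper descent gain by argo
  let ?\<phi> = "27 * (2 - q) / q"
  have "\<beta>\<^sup>2 * (8 * m\<^sup>2 * U / real b + (24 + ?\<phi>) * gap_bound s / real b - 3/16 * (m + 4) * m * (1 + 128 / (real b * q\<^sup>2)) * U)
    \<le> \<beta>\<^sup>2 * (?\<phi> * W / real b - 3/2 * W / real b - 3/16 * m\<^sup>2 * U)"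
    unfolding gb by (rule mult_left_mono[OF noise_budget]) (use q_range bq_range m nn in auto)
  then have 2: "4 * (2 * (\<beta>\<^sup>2 / real b)) * m\<^sup>2 * U + (12 * (2 * (\<beta>\<^sup>2 / real b)) + gap_weight) * gap_bound s
      - 3/16 * (m + 4) * (m * \<beta>\<^sup>2 * (1 + 128 / (real b * q\<^sup>2)) * U)
    \<le> gap_weight * W - 3/2 * (\<beta>\<^sup>2 / real b) * W - 3/16 * \<beta>\<^sup>2 * (m\<^sup>2 * U)"
    unfolding gap_weight_def by argo
  have "potential xs k s = energy m (xc - xs) v e + gap_weight * W"
    by (simp add: s_def v_def m_def e_def W_def)
  with 1 2 show ?thesis
    unfolding s_def[symmetric] v_def[symmetric] c_def[symmetric] m_def[symmetric] U_def[symmetric] W_def[symmetric]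
    by argo
qed

text \<open>Time \<open>1\<close> is reached from time \<open>0\<close>, where the velocity vanishes, by a noiseless step.\<close>
lemma potential_start:
  assumes "xs \<in> zer g"
  shows "potential xs 1 (run []) \<le> 4 * (norm (x0 - xs))\<^sup>2"
proof -
  let ?c = "\<beta> *\<^sub>R g x0"
  have st: "x0 - eta \<beta> 0 *\<^sub>R g x0 = x0 + step 0 0 ?c"
    by (simp add: step_def eta_def)
  have "energy (0 + 1) ((x0 - xs) + step 0 0 ?c) (vel (0 + 1) (step 0 0 ?c) ?c) ?c
     \<le> energy 0 (x0 - xs) 0 ?c - 1/5 * ((norm (0 :: real^'p))\<^sup>2 / (0 + 5) + (0 + 5) * (norm ?c)\<^sup>2)
      - 3/16 * (0 + 4) * ((0 - (2 * 0) *\<^sub>R ?c) \<bullet> (?c - ?c) - 0 * (norm (?c - ?c))\<^sup>2)"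
    using operator_inner_ge[OF assms, of x0] by (intro energy_descent) auto
  also have "\<dots> \<le> energy 0 (x0 - xs) 0 ?c" by simp
  also have "\<dots> = 4 * (norm (x0 - xs))\<^sup>2"
    by (simp add: energy_def corrector_def power_mult_distrib)
  finally show ?thesis
    unfolding run.simps st by (simp add: mean_sq_def algebra_simps)
qed

lemma velocity_advance:
  assumes "k \<ge> 1"
  shows "measure_pmf.expectation draw_pmf (\<lambda>d. (norm (velocity (Suc k) (advance k (xc, xp, u) d)))\<^sup>2)
    \<le> (norm (velocity k (xc, xp, u)))\<^sup>2 + (norm (velocity k (xc, xp, u)))\<^sup>2 / (real k + 5)
      + 20 * ((real k + 5) * (norm (\<beta> *\<^sub>R g xc))\<^sup>2)
      + 16 * \<beta>\<^sup>2 * ((real k)\<^sup>2 * variation (xc, xp, u)) + 48 * \<beta>\<^sup>2 * gap_bound (xc, xp, u)"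
proof -
  define m s v c where "m = real k" and "s = (xc, xp, u)" and "v = velocity k s" and "c = \<beta> *\<^sub>R g xc"
  have m: "m \<ge> 1" using assms by (simp add: m_def)
  define F where "F = (\<lambda>y. (norm (vel (m + 1) (y - xc) c))\<^sup>2)"
  define K where "K = (m + 1)\<^sup>2 * (4 * \<beta>\<^sup>2 / (real b * (m + 5)\<^sup>2))"
  have F: "F (xc + (step m v c - d)) = (norm (vel (m + 1) (step m v c) c))\<^sup>2
      + ((- 2 * (m + 1)) *\<^sub>R vel (m + 1) (step m v c) c) \<bullet> d + (m + 1)\<^sup>2 * (norm d)\<^sup>2" for d
    unfolding F_def using vel_perturb[of "m + 1" "step m v c" d c] by simp
  have gb_nn: "gap_bound s \<ge> 0" unfolding gap_bound_def using gap_nonneg q_range by simp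
  have K: "K \<le> 4 * \<beta>\<^sup>2"
  proof -
    have "(m + 1)\<^sup>2 \<le> real b * (m + 5)\<^sup>2"
      using mult_mono[of 1 "real b" "(m + 1)\<^sup>2" "(m + 5)\<^sup>2"] b_pos m by (simp add: power_mono)
    then have "(m + 1)\<^sup>2 / (real b * (m + 5)\<^sup>2) \<le> 1"
      using b_pos m by (subst divide_le_eq_1) auto
    from mult_right_mono[OF this, of "4 * \<beta>\<^sup>2"] show ?thesis by (simp add: K_def)
  qed
  have "(norm (velocity (Suc k) (advance k s d)))\<^sup>2 = F (fst (advance k s d)) + 0 * snapshot_gap (advance k s d)" for d
    by (cases d) (simp add: s_def F_def c_def m_def add.commute[of 1])
  then have "measure_pmf.expectation draw_pmf (\<lambda>d. (norm (velocity (Suc k) (advance k s d)))\<^sup>2)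
    \<le> (norm (vel (m + 1) (step m v c) c))\<^sup>2 + 4 * K * m\<^sup>2 * variation s + (12 * K + 0) * gap_bound s"
    using advance_expectation_le[of F xc k xp u, OF F[unfolded m_def v_def s_def c_def], of 0]
    by (simp only: s_def m_def c_def v_def K_def) simp
  also have "\<dots> \<le> (norm (vel (m + 1) (step m v c) c))\<^sup>2 + 4 * (4 * \<beta>\<^sup>2) * m\<^sup>2 * variation s + (12 * (4 * \<beta>\<^sup>2) + 0) * gap_bound s"
    using K gb_nn gap_nonneg by (intro add_mono mult_right_mono mult_left_mono order_refl) auto
  also have "(norm (vel (m + 1) (step m v c) c))\<^sup>2 \<le> (norm v)\<^sup>2 + (norm v)\<^sup>2 / (m + 5) + 20 * ((m + 5) * (norm c)\<^sup>2)"
    by (rule vel_step_le) (use m in simp)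
  finally show ?thesis
    by (simp add: m_def s_def v_def c_def mult.assoc)
qed

fun correction :: "nat \<Rightarrow> (real^'p) \<times> (real^'p) \<times> (real^'p) \<Rightarrow> real" where
  "correction k (xc, xp, u) = corrector (real k) (velocity k (xc, xp, u)) (\<beta> *\<^sub>R g xp)"

text \<open>No variance enters, because the corrector is affine in the increment.\<close>
lemma correction_advance:
  assumes "k \<ge> 1"
  shows "measure_pmf.expectation draw_pmf (\<lambda>d. correction (Suc k) (advance k (xc, xp, u) d))
    \<le> correction k (xc, xp, u) + 3/2 * ((norm (velocity k (xc, xp, u)))\<^sup>2 / (real k + 5))
      + 3/2 * ((real k + 5) * (norm (\<beta> *\<^sub>R g xc))\<^sup>2)"
proof -
  define m s v c e where "m = real k" and "s = (xc, xp, u)" and "v = velocity k s" and "c = \<beta> *\<^sub>R g xc" and "e = \<beta> *\<^sub>R g xp"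
  have m: "m \<ge> 1" using assms by (simp add: m_def)
  define F where "F = (\<lambda>y. corrector (m + 1) (vel (m + 1) (y - xc) c) c)"
  have F: "F (xc + (step m v c - d)) = corrector (m + 1) (vel (m + 1) (step m v c) c) c
      + (((m + 1) * (m + 1 + 4)) *\<^sub>R c) \<bullet> d + 0 * (norm d)\<^sup>2" for d
    unfolding F_def using corrector_perturb[of "m + 1" "step m v c" d c] by simp
  have "correction (Suc k) (advance k s d) = F (fst (advance k s d)) + 0 * snapshot_gap (advance k s d)" for d
    by (cases d) (simp add: s_def F_def c_def m_def add.commute[of 1])
  then have upper: "measure_pmf.expectation draw_pmf (\<lambda>d. correction (Suc k) (advance k s d))
    \<le> corrector (m + 1) (vel (m + 1) (step m v c) c) c"
    using advance_expectation_le[of F xc k xp u, OF F[unfolded m_def v_def s_def c_def], of 0]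
    by (simp only: s_def m_def c_def v_def) simp
  have mean: "corrector (m + 1) (vel (m + 1) (step m v c) c) c
    = corrector m v e + 3 * (v \<bullet> c) - (2 * m - 1) * (norm c)\<^sup>2
    - (m + 4) * ((v - (2 * m) *\<^sub>R e) \<bullet> (c - e) - m * (norm (c - e))\<^sup>2)"
    by (rule corrector_step) (use m in simp)
  have nonneg: "(2 * m - 1) * (norm c)\<^sup>2 \<ge> 0" using m by simp
  have gain: "(m + 4) * ((v - (2 * m) *\<^sub>R e) \<bullet> (c - e) - m * (norm (c - e))\<^sup>2) \<ge> 0"
  proof -
    have "0 \<le> m * \<beta>\<^sup>2 * (1 + 128 / (real b * q\<^sup>2)) * variation s"
      using m gap_nonneg by simp
    also have "\<dots> \<le> (v - (2 * m) *\<^sub>R e) \<bullet> (c - e) - m * (norm (c - e))\<^sup>2"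
      using increment_inner_ge[of k xc xp u] by (simp only: m_def s_def v_def c_def e_def)
    finally show ?thesis using m by simp
  qed
  have young: "3 * (v \<bullet> c) \<le> 3/2 * ((norm v)\<^sup>2 / (m + 5)) + 3/2 * ((m + 5) * (norm c)\<^sup>2)"
    using inner_young[of "m + 5" v c] m by (simp add: field_simps)
  have "measure_pmf.expectation draw_pmf (\<lambda>d. correction (Suc k) (advance k s d))
    \<le> corrector m v e + 3/2 * ((norm v)\<^sup>2 / (m + 5)) + 3/2 * ((m + 5) * (norm c)\<^sup>2)"
    using upper mean nonneg gain young by argo
  moreover have "correction k s = corrector m v e"
    by (simp add: s_def v_def m_def e_def)
  ultimately show ?thesis
    by (simp only: m_def s_def v_def c_def)
qed

end

section \<open>Rates, limits and complexity\<close>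
context vfkm_svrg
begin

definition mean_state :: "nat \<Rightarrow> ((real^'p) \<times> (real^'p) \<times> (real^'p) \<Rightarrow> real) \<Rightarrow> real" where
  "mean_state k f = expectation (\<lambda>\<omega>. f (state k \<omega>))"

lemma mean_state_linear:
  shows mean_state_add: "mean_state k (\<lambda>s. f s + h s) = mean_state k f + mean_state k h"
    and mean_state_diff: "mean_state k (\<lambda>s. f s - h s) = mean_state k f - mean_state k h"
    and mean_state_mult: "mean_state k (\<lambda>s. r * f s) = r * mean_state k f"
    and mean_state_divide: "mean_state k (\<lambda>s. f s / r) = mean_state k f / r"
  unfolding mean_state_def using expectation_state(1)[of f k] expectation_state(1)[of h k] by simp_all

lemma mean_state_mono: "(\<And>s. f s \<le> h s) \<Longrightarrow> mean_state k f \<le> mean_state k h"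
  unfolding mean_state_def by (intro integral_mono expectation_state(1))

lemma mean_state_nonneg: "(\<And>s. 0 \<le> f s) \<Longrightarrow> 0 \<le> mean_state k f"
  unfolding mean_state_def by (rule Bochner_Integration.integral_nonneg)

definition velocity_sq :: "nat \<Rightarrow> real" where
  "velocity_sq k = mean_state k (\<lambda>s. (norm (velocity (Suc k) s))\<^sup>2)"
definition residual_sq :: "nat \<Rightarrow> real" where
  "residual_sq k = expectation (\<lambda>\<omega>. (norm (\<beta> *\<^sub>R g (x k \<omega>)))\<^sup>2)"

text \<open>The same quantity is read off a state at either of its two iterates, according to whether it
  is the current or the previous one.\<close>
lemma residual_sq_state:
  "residual_sq (Suc k) = mean_state k (\<lambda>s. (norm (\<beta> *\<^sub>R g (fst s)))\<^sup>2)"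
  "residual_sq k = mean_state k (\<lambda>s. (norm (\<beta> *\<^sub>R g (fst (snd s))))\<^sup>2)"
  by (simp_all add: residual_sq_def mean_state_def state_def)

lemma summands_le_potential:
  "3/512 * (real k + 2) * (real k + 5) * (norm (\<beta> *\<^sub>R g (fst (snd s))))\<^sup>2 \<le> potential xs (Suc k) s"
  "3/320 * (real k + 5)\<^sup>2 * (norm (fst s - fst (snd s)))\<^sup>2 \<le> potential xs (Suc k) s"
proof -
  obtain xc xp u where s: "s = (xc, xp, u)" by (cases s)
  have gap: "0 \<le> gap_weight * snapshot_gap s"
    using gap_weight_nonneg gap_nonneg by simp
  have m: "real (Suc k) \<ge> 1" "real (Suc k) + 1 = real k + 2" "real (Suc k) + 4 = real k + 5" by auto
  show "3/512 * (real k + 2) * (real k + 5) * (norm (\<beta> *\<^sub>R g (fst (snd s))))\<^sup>2 \<le> potential xs (Suc k) s"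
    using operator_le_energy[OF m(1), of "\<beta> *\<^sub>R g xp" "xc - xs" "velocity (Suc k) s"] gap
    unfolding s m potential_simp fst_conv snd_conv by linarith
  show "3/320 * (real k + 5)\<^sup>2 * (norm (fst s - fst (snd s)))\<^sup>2 \<le> potential xs (Suc k) s"
    using increment_le_energy[OF m(1), of "xc - xp" "xc - xs" "\<beta> *\<^sub>R g xp"] gap
    unfolding s m potential_simp velocity.simps fst_conv snd_conv by linarith
qed

lemma potential_nonneg: "0 \<le> potential xs (Suc k) s"
  using summands_le_potential(2)[of k s xs] by (meson order_trans mult_nonneg_nonneg zero_le_power2 of_nat_0_le_iff
      divide_nonneg_nonneg zero_le_numeral)

lemma mean_potential_step:
  assumes "xs \<in> zer g"
  shows "mean_state (Suc k) (potential xs (Suc (Suc k))) +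
    (1/5 * (velocity_sq k / (real k + 6) + (real k + 6) * residual_sq (Suc k))
      + 3/16 * \<beta>\<^sup>2 * ((real (Suc k))\<^sup>2 * mean_state k variation)
      + 3/2 * (\<beta>\<^sup>2 / real b) * mean_state k snapshot_gap)
    \<le> mean_state k (potential xs (Suc k))"
proof -
  have e: "real (Suc k) + 5 = real k + 6" by simp
  have "mean_state (Suc k) (potential xs (Suc (Suc k))) \<le> mean_state k (\<lambda>s. potential xs (Suc k) s
      - (1/5 * ((norm (velocity (Suc k) s))\<^sup>2 / (real k + 6) + (real k + 6) * (norm (\<beta> *\<^sub>R g (fst s)))\<^sup>2)
         + 3/16 * \<beta>\<^sup>2 * ((real (Suc k))\<^sup>2 * variation s) + 3/2 * (\<beta>\<^sup>2 / real b) * snapshot_gap s))"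
    unfolding mean_state_def
  proof (rule expectation_state_Suc_le)
    fix s :: "(real^'p) \<times> (real^'p) \<times> (real^'p)"
    obtain xc xp u where s: "s = (xc, xp, u)" by (cases s)
    show "measure_pmf.expectation draw_pmf (\<lambda>d. potential xs (Suc (Suc k)) (advance (Suc k) s d))
      \<le> potential xs (Suc k) s
      - (1/5 * ((norm (velocity (Suc k) s))\<^sup>2 / (real k + 6) + (real k + 6) * (norm (\<beta> *\<^sub>R g (fst s)))\<^sup>2)
         + 3/16 * \<beta>\<^sup>2 * ((real (Suc k))\<^sup>2 * variation s) + 3/2 * (\<beta>\<^sup>2 / real b) * snapshot_gap s)"
      using potential_advance[OF assms, of "Suc k" xc xp u] unfolding s e fst_conv by simp
  qed
  also have "\<dots> = mean_state k (potential xs (Suc k)) -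
    (1/5 * (velocity_sq k / (real k + 6) + (real k + 6) * residual_sq (Suc k))
      + 3/16 * \<beta>\<^sup>2 * ((real (Suc k))\<^sup>2 * mean_state k variation)
      + 3/2 * (\<beta>\<^sup>2 / real b) * mean_state k snapshot_gap)"
    unfolding mean_state_linear velocity_sq_def residual_sq_state(1) ..
  finally show ?thesis by simp
qed

lemma mean_potential_le:
  assumes "xs \<in> zer g"
  shows "mean_state k (potential xs (Suc k)) \<le> 4 * (norm (x0 - xs))\<^sup>2"
proof (induction k)
  case 0
  have "mean_state 0 (potential xs (Suc 0)) = potential xs 1 (run [])"
    unfolding mean_state_def expectation_state(2) by simp
  then show ?case using potential_start[OF assms] by simp
next
  case (Suc k)
  have "0 \<le> 1/5 * (velocity_sq k / (real k + 6) + (real k + 6) * residual_sq (Suc k))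
      + 3/16 * \<beta>\<^sup>2 * ((real (Suc k))\<^sup>2 * mean_state k variation)
      + 3/2 * (\<beta>\<^sup>2 / real b) * mean_state k snapshot_gap"
    unfolding velocity_sq_def residual_sq_state(1)
    by (intro add_nonneg_nonneg mult_nonneg_nonneg divide_nonneg_nonneg mean_state_nonneg gap_nonneg) auto
  then show ?case using mean_potential_step[OF assms, of k] Suc.IH by linarith
qed

lemma increment_bound:
  assumes "xs \<in> zer g"
  shows "(real k + 5)\<^sup>2 * expectation (\<lambda>\<omega>. (norm (x (Suc k) \<omega> - x k \<omega>))\<^sup>2) \<le> 1280/3 * (norm (x0 - xs))\<^sup>2"
proof -
  have "3/320 * (real k + 5)\<^sup>2 * mean_state k (\<lambda>s. (norm (fst s - fst (snd s)))\<^sup>2) \<le> mean_state k (potential xs (Suc k))"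
    unfolding mean_state_mult[symmetric] by (rule mean_state_mono) (rule summands_le_potential)
  also have "\<dots> \<le> 4 * (norm (x0 - xs))\<^sup>2" by (rule mean_potential_le[OF assms])
  finally show ?thesis by (simp add: mean_state_def state_def)
qed

lemma residual_bound:
  assumes "xs \<in> zer g"
  shows "(real k + 2) * (real k + 5) * residual_sq k \<le> 2048/3 * (norm (x0 - xs))\<^sup>2"
proof -
  have "3/512 * (real k + 2) * (real k + 5) * residual_sq k \<le> mean_state k (potential xs (Suc k))"
    unfolding residual_sq_state(2) mean_state_mult[symmetric] by (rule mean_state_mono) (rule summands_le_potential)
  also have "\<dots> \<le> 4 * (norm (x0 - xs))\<^sup>2" by (rule mean_potential_le[OF assms])
  finally show ?thesis by (simp add: algebra_simps)
qed

lemma means_nonneg: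
  "velocity_sq k \<ge> 0" "residual_sq k \<ge> 0" "mean_state k variation \<ge> 0" "mean_state k snapshot_gap \<ge> 0"
  unfolding velocity_sq_def residual_sq_state(2)
  by (intro mean_state_nonneg; simp add: gap_nonneg)+

text \<open>Everything that a step dissipates is bounded by the decrease of a nonnegative quantity.\<close>
lemma summable_dissipation:
  shows "summable (\<lambda>k. velocity_sq k / (real k + 6))"
    and "summable (\<lambda>k. (real k + 6) * residual_sq (Suc k))"
    and "summable (\<lambda>k. (real (Suc k))\<^sup>2 * mean_state k variation)"
    and "summable (\<lambda>k. mean_state k snapshot_gap)"
proof -
  obtain xs where xs: "xs \<in> zer g" using zer_nonempty by blast
  define A B' C D where "A = (\<lambda>k. velocity_sq k / (real k + 6))"
    and "B' = (\<lambda>k. (real k + 6) * residual_sq (Suc k))"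
    and "C = (\<lambda>k. (real (Suc k))\<^sup>2 * mean_state k variation)"
    and "D = (\<lambda>k. mean_state k snapshot_gap)"
  have nn: "A k \<ge> 0" "B' k \<ge> 0" "C k \<ge> 0" "D k \<ge> 0" for k
    unfolding A_def B'_def C_def D_def using means_nonneg by simp_all
  define r where "r = 3/2 * (\<beta>\<^sup>2 / real b)"
  have r: "r > 0" using \<beta>_pos b_pos by (simp add: r_def)
  define f where "f = (\<lambda>k. 1/5 * (A k + B' k) + 3/16 * \<beta>\<^sup>2 * C k + r * D k)"
  have sum: "summable f"
  proof (rule summable_of_decrease[where l = "\<lambda>k. mean_state k (potential xs (Suc k))"])
    show "mean_state (Suc k) (potential xs (Suc (Suc k))) + f k \<le> mean_state k (potential xs (Suc k))" for k
      unfolding f_def A_def B'_def C_def D_def r_def by (rule mean_potential_step[OF xs])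
    show "f k \<ge> 0" for k unfolding f_def using nn r by simp
    show "mean_state k (potential xs (Suc k)) \<ge> 0" for k by (intro mean_state_nonneg potential_nonneg)
  qed
  have part: "summable h" if "\<And>k. h k \<ge> 0" "c > 0" "\<And>k. c * h k \<le> f k" for h :: "nat \<Rightarrow> real" and c
  proof -
    have "summable (\<lambda>k. c * h k)"
      by (rule summable_comparison_test_ev[OF _ sum]) (use that in auto)
    then show ?thesis using that(2) by (subst (asm) summable_cmult_iff) auto
  qed
  have nn': "3/16 * \<beta>\<^sup>2 * C k \<ge> 0" "r * D k \<ge> 0" for k using nn r by simp_all
  have "1/5 * A k \<le> f k" "1/5 * B' k \<le> f k" "3/16 * \<beta>\<^sup>2 * C k \<le> f k" "r * D k \<le> f k" for k
    using nn[of k] nn'[of k] unfolding f_def by argo+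
  then show "summable A" "summable B'" "summable C" "summable D"
    using \<beta>_pos r by (auto intro!: part[OF nn(1), of "1/5"] part[OF nn(2), of "1/5"]
       part[OF nn(3), of "3/16 * \<beta>\<^sup>2"] part[OF nn(4), of r])
qed

lemma summable_weighted_velocity: "summable (\<lambda>k. velocity_sq k / real (Suc k))"
proof (rule summable_comparison_test_ev[OF _ summable_mult[OF summable_dissipation(1), of 6]])
  have "velocity_sq k / real (Suc k) \<le> 6 * (velocity_sq k / (real k + 6))" for k
    using means_nonneg(1)[of k] by (simp add: divide_simps) (simp add: algebra_simps)
  then show "eventually (\<lambda>k. norm (velocity_sq k / real (Suc k)) \<le> 6 * (velocity_sq k / (real k + 6))) sequentially"
    using means_nonneg(1) by (intro always_eventually allI) simp
qed

definition velocity_drift :: "nat \<Rightarrow> real" where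
  "velocity_drift k = velocity_sq k / (real k + 6) + 20 * ((real k + 6) * residual_sq (Suc k))
     + 16 * \<beta>\<^sup>2 * ((real (Suc k))\<^sup>2 * mean_state k variation)
     + 48 * \<beta>\<^sup>2 * ((1 - q / 2) * mean_state k snapshot_gap + 2 / q * mean_state k variation)"

text \<open>The velocity may grow only by quantities whose sum is finite.\<close>
lemma velocity_sq_step: "velocity_sq (Suc k) \<le> velocity_sq k + velocity_drift k"
proof -
  have e: "real (Suc k) + 5 = real k + 6" by simp
  have "velocity_sq (Suc k) \<le> mean_state k (\<lambda>s. (norm (velocity (Suc k) s))\<^sup>2 + (norm (velocity (Suc k) s))\<^sup>2 / (real k + 6)
      + 20 * ((real k + 6) * (norm (\<beta> *\<^sub>R g (fst s)))\<^sup>2)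
      + 16 * \<beta>\<^sup>2 * ((real (Suc k))\<^sup>2 * variation s) + 48 * \<beta>\<^sup>2 * ((1 - q / 2) * snapshot_gap s + 2 / q * variation s))"
    unfolding velocity_sq_def mean_state_def
  proof (rule expectation_state_Suc_le)
    fix s :: "(real^'p) \<times> (real^'p) \<times> (real^'p)"
    obtain xc xp u where s: "s = (xc, xp, u)" by (cases s)
    show "measure_pmf.expectation draw_pmf (\<lambda>d. (norm (velocity (Suc (Suc k)) (advance (Suc k) s d)))\<^sup>2)
      \<le> (norm (velocity (Suc k) s))\<^sup>2 + (norm (velocity (Suc k) s))\<^sup>2 / (real k + 6)
      + 20 * ((real k + 6) * (norm (\<beta> *\<^sub>R g (fst s)))\<^sup>2)
      + 16 * \<beta>\<^sup>2 * ((real (Suc k))\<^sup>2 * variation s) + 48 * \<beta>\<^sup>2 * ((1 - q / 2) * snapshot_gap s + 2 / q * variation s)"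
      using velocity_advance[of "Suc k" xc xp u] unfolding s e fst_conv gap_bound_def by simp
  qed
  then show ?thesis
    unfolding mean_state_linear velocity_drift_def velocity_sq_def residual_sq_state(1) by (simp only: add.assoc)
qed

lemma summable_velocity_drift: "summable velocity_drift"
proof -
  have "summable (\<lambda>k. mean_state k variation)"
  proof (rule summable_comparison_test_ev[OF _ summable_dissipation(3)])
    have "1 * mean_state k variation \<le> (real (Suc k))\<^sup>2 * mean_state k variation" for k
      using means_nonneg(3)[of k] by (intro mult_right_mono) auto
    then show "eventually (\<lambda>k. norm (mean_state k variation) \<le> (real (Suc k))\<^sup>2 * mean_state k variation) sequentially"
      using means_nonneg(3) by (intro always_eventually allI) (simp del: of_nat_Suc)
  qed
  then show ?thesis
    unfolding velocity_drift_def by (intro summable_add summable_mult summable_dissipation)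
qed

lemma velocity_sq_tendsto_0: "velocity_sq \<longlonglongrightarrow> 0"
  by (rule tendsto_0_of_almost_decreasing[OF means_nonneg(1) velocity_sq_step summable_velocity_drift
        summable_weighted_velocity])

lemma correction_bounds:
  "1/2 * ((real (Suc k))\<^sup>2 * (norm (\<beta> *\<^sub>R g (fst (snd s))))\<^sup>2)
    \<le> correction (Suc k) s + 5/2 * (norm (velocity (Suc k) s))\<^sup>2"
  "correction (Suc k) s + 5/2 * (norm (velocity (Suc k) s))\<^sup>2
    \<le> 5 * (norm (velocity (Suc k) s))\<^sup>2 + 8 * ((real (Suc k))\<^sup>2 * (norm (\<beta> *\<^sub>R g (fst (snd s))))\<^sup>2)"
proof -
  obtain xc xp u where s: "s = (xc, xp, u)" by (cases s)
  have m: "real (Suc k) \<ge> 1" by simp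
  show "1/2 * ((real (Suc k))\<^sup>2 * (norm (\<beta> *\<^sub>R g (fst (snd s))))\<^sup>2)
      \<le> correction (Suc k) s + 5/2 * (norm (velocity (Suc k) s))\<^sup>2"
    and "correction (Suc k) s + 5/2 * (norm (velocity (Suc k) s))\<^sup>2
      \<le> 5 * (norm (velocity (Suc k) s))\<^sup>2 + 8 * ((real (Suc k))\<^sup>2 * (norm (\<beta> *\<^sub>R g (fst (snd s))))\<^sup>2)"
    unfolding s correction.simps fst_conv snd_conv by (rule corrector_bounds[OF m])+
qed

text \<open>The corrector plus \<open>5/2\<close> of the squared velocity is nonnegative, almost decreasing, and
  summable with weight \<open>1 / k\<close>.\<close>
lemma scaled_residual_tendsto_0: "(\<lambda>k. (real (Suc k))\<^sup>2 * residual_sq k) \<longlonglongrightarrow> 0"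
proof -
  define Y where "Y = (\<lambda>k. mean_state k (correction (Suc k)) + 5/2 * velocity_sq k)"
  have lower: "1/2 * ((real (Suc k))\<^sup>2 * residual_sq k) \<le> Y k" for k
    unfolding Y_def velocity_sq_def residual_sq_state(2) mean_state_linear[symmetric]
    by (rule mean_state_mono) (rule correction_bounds)
  have upper: "Y k \<le> 5 * velocity_sq k + 8 * ((real (Suc k))\<^sup>2 * residual_sq k)" for k
    unfolding Y_def velocity_sq_def residual_sq_state(2) mean_state_linear[symmetric]
    by (rule mean_state_mono) (rule correction_bounds)
  have Y_nonneg: "Y k \<ge> 0" for k
    using lower[of k] means_nonneg(2)[of k] by (meson order_trans mult_nonneg_nonneg zero_le_power2 zero_le_divide_1_iff zero_le_numeral)
  have correction_step: "mean_state (Suc k) (correction (Suc (Suc k))) \<le> mean_state k (correction (Suc k))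
     + 3/2 * (velocity_sq k / (real k + 6)) + 3/2 * ((real k + 6) * residual_sq (Suc k))" for k
  proof -
    have e: "real (Suc k) + 5 = real k + 6" by simp
    have "mean_state (Suc k) (correction (Suc (Suc k))) \<le> mean_state k (\<lambda>s. correction (Suc k) s
       + 3/2 * ((norm (velocity (Suc k) s))\<^sup>2 / (real k + 6)) + 3/2 * ((real k + 6) * (norm (\<beta> *\<^sub>R g (fst s)))\<^sup>2))"
      unfolding mean_state_def
    proof (rule expectation_state_Suc_le)
      fix s :: "(real^'p) \<times> (real^'p) \<times> (real^'p)"
      obtain xc xp u where s: "s = (xc, xp, u)" by (cases s)
      show "measure_pmf.expectation draw_pmf (\<lambda>d. correction (Suc (Suc k)) (advance (Suc k) s d))
        \<le> correction (Suc k) s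
         + 3/2 * ((norm (velocity (Suc k) s))\<^sup>2 / (real k + 6)) + 3/2 * ((real k + 6) * (norm (\<beta> *\<^sub>R g (fst s)))\<^sup>2)"
        using correction_advance[of "Suc k" xc xp u] unfolding s e fst_conv by simp
    qed
    then show ?thesis
      unfolding mean_state_linear velocity_sq_def residual_sq_state(1) .
  qed
  define f where "f = (\<lambda>k. 3/2 * (velocity_sq k / (real k + 6)) + 3/2 * ((real k + 6) * residual_sq (Suc k))
    + 5/2 * velocity_drift k)"
  have Y_step: "Y (Suc k) \<le> Y k + f k" for k
    using correction_step[of k] velocity_sq_step[of k] unfolding Y_def f_def by argo
  have f: "summable f"
    unfolding f_def by (intro summable_add summable_mult summable_dissipation summable_velocity_drift)
  have "summable (\<lambda>k. real (Suc (Suc k)) * residual_sq (Suc k))"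
  proof (rule summable_comparison_test_ev[OF _ summable_dissipation(2)])
    have "real (Suc (Suc k)) * residual_sq (Suc k) \<le> (real k + 6) * residual_sq (Suc k)" for k
      using means_nonneg(2) by (intro mult_right_mono) auto
    then show "eventually (\<lambda>k. norm (real (Suc (Suc k)) * residual_sq (Suc k)) \<le> (real k + 6) * residual_sq (Suc k)) sequentially"
      using means_nonneg(2) by (intro always_eventually allI) (simp del: of_nat_Suc)
  qed
  then have residual: "summable (\<lambda>k. real (Suc k) * residual_sq k)"
    by (subst summable_Suc_iff[symmetric])
  have "summable (\<lambda>k. Y k / real (Suc k))"
  proof (rule summable_comparison_test_ev)
    show "summable (\<lambda>k. 5 * (velocity_sq k / real (Suc k)) + 8 * (real (Suc k) * residual_sq k))"
      by (intro summable_add summable_mult summable_weighted_velocity residual)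
    have "Y k / real (Suc k) \<le> 5 * (velocity_sq k / real (Suc k)) + 8 * (real (Suc k) * residual_sq k)" for k
    proof -
      have "Y k / real (Suc k) \<le> (5 * velocity_sq k + 8 * ((real (Suc k))\<^sup>2 * residual_sq k)) / real (Suc k)"
        by (intro divide_right_mono upper) simp
      then show ?thesis by (simp add: add_divide_distrib power2_eq_square del: of_nat_Suc)
    qed
    then show "eventually (\<lambda>k. norm (Y k / real (Suc k)) \<le> 5 * (velocity_sq k / real (Suc k)) + 8 * (real (Suc k) * residual_sq k)) sequentially"
      using Y_nonneg by (intro always_eventually allI) (simp del: of_nat_Suc)
  qed
  then have "Y \<longlonglongrightarrow> 0"
    by (rule tendsto_0_of_almost_decreasing[OF Y_nonneg Y_step f])
  then have "(\<lambda>k. 2 * Y k) \<longlonglongrightarrow> 0"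
    using tendsto_mult_left[of Y 0 sequentially 2] by simp
  then show ?thesis
  proof (rule tendsto_sandwich[OF _ _ tendsto_const, rotated -1])
    show "eventually (\<lambda>k. 0 \<le> (real (Suc k))\<^sup>2 * residual_sq k) sequentially"
      using means_nonneg(2) by (intro always_eventually allI) simp
    show "eventually (\<lambda>k. (real (Suc k))\<^sup>2 * residual_sq k \<le> 2 * Y k) sequentially"
    proof (intro always_eventually allI)
      show "(real (Suc k))\<^sup>2 * residual_sq k \<le> 2 * Y k" for k
        using lower[of k] by argo
    qed
  qed
qed

lemma residual_limit: "(\<lambda>k. (real k)\<^sup>2 * expectation (\<lambda>\<omega>. (norm (g (x k \<omega>)))\<^sup>2)) \<longlonglongrightarrow> 0"
proof -
  have e: "residual_sq k = \<beta>\<^sup>2 * expectation (\<lambda>\<omega>. (norm (g (x k \<omega>)))\<^sup>2)" for k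
    by (simp add: residual_sq_def power_mult_distrib)
  have nn: "0 \<le> expectation (\<lambda>\<omega>. (norm (g (x k \<omega>)))\<^sup>2)" for k
    by (rule Bochner_Integration.integral_nonneg) simp
  have "(\<lambda>k. 1 / \<beta>\<^sup>2 * ((real (Suc k))\<^sup>2 * residual_sq k)) \<longlonglongrightarrow> 1 / \<beta>\<^sup>2 * 0"
    by (intro tendsto_mult_left scaled_residual_tendsto_0)
  then have "(\<lambda>k. (real (Suc k))\<^sup>2 * expectation (\<lambda>\<omega>. (norm (g (x k \<omega>)))\<^sup>2)) \<longlonglongrightarrow> 0"
    unfolding e using \<beta>_pos by simp
  then show ?thesis
  proof (rule tendsto_sandwich[OF _ _ tendsto_const, rotated -1])
    show "eventually (\<lambda>k. 0 \<le> (real k)\<^sup>2 * expectation (\<lambda>\<omega>. (norm (g (x k \<omega>)))\<^sup>2)) sequentially"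
      using nn by (intro always_eventually allI) simp
    show "eventually (\<lambda>k. (real k)\<^sup>2 * expectation (\<lambda>\<omega>. (norm (g (x k \<omega>)))\<^sup>2)
        \<le> (real (Suc k))\<^sup>2 * expectation (\<lambda>\<omega>. (norm (g (x k \<omega>)))\<^sup>2)) sequentially"
      using nn by (intro always_eventually allI mult_right_mono power_mono) auto
  qed
qed

text \<open>The increment at time \<open>k + 1\<close> is the velocity minus twice the scaled operator value, both of
  which vanish in mean square after multiplication by \<open>k + 1\<close>.\<close>
lemma increment_limit: "(\<lambda>k. (real k)\<^sup>2 * expectation (\<lambda>\<omega>. (norm (x (Suc k) \<omega> - x k \<omega>))\<^sup>2)) \<longlonglongrightarrow> 0"
proof -
  let ?d = "\<lambda>k. expectation (\<lambda>\<omega>. (norm (x (Suc k) \<omega> - x k \<omega>))\<^sup>2)"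
  have nn: "0 \<le> ?d k" for k
    by (rule Bochner_Integration.integral_nonneg) simp
  have "(real (Suc k))\<^sup>2 * ?d k \<le> 2 * velocity_sq k + 8 * ((real (Suc k))\<^sup>2 * residual_sq k)" for k
  proof -
    have "(real (Suc k))\<^sup>2 * (norm (fst s - fst (snd s)))\<^sup>2
      \<le> 2 * (norm (velocity (Suc k) s))\<^sup>2 + 8 * ((real (Suc k))\<^sup>2 * (norm (\<beta> *\<^sub>R g (fst (snd s))))\<^sup>2)" for s
    proof -
      obtain xc xp u where s: "s = (xc, xp, u)" by (cases s)
      define m where "m = real (Suc k)"
      define c where "c = \<beta> *\<^sub>R g xp"
      have "m *\<^sub>R (xc - xp) = vel m (xc - xp) c + (- 2 * m) *\<^sub>R c"
        by (simp add: vel_def algebra_simps)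
      then have "(norm (m *\<^sub>R (xc - xp)))\<^sup>2 \<le> (1 + 1) * (norm (vel m (xc - xp) c))\<^sup>2 + (1 + 1 / 1) * (norm ((- 2 * m) *\<^sub>R c))\<^sup>2"
        using norm_add_sq_le[of 1 "vel m (xc - xp) c" "(- 2 * m) *\<^sub>R c"] by (simp only:)
      then show ?thesis
        unfolding s velocity.simps fst_conv snd_conv m_def[symmetric] c_def[symmetric]
        by (simp only: norm_scaleR power_mult_distrib power2_abs) simp
    qed
    then have "mean_state k (\<lambda>s. (real (Suc k))\<^sup>2 * (norm (fst s - fst (snd s)))\<^sup>2)
      \<le> mean_state k (\<lambda>s. 2 * (norm (velocity (Suc k) s))\<^sup>2 + 8 * ((real (Suc k))\<^sup>2 * (norm (\<beta> *\<^sub>R g (fst (snd s))))\<^sup>2))"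
      by (rule mean_state_mono)
    then show ?thesis
      unfolding mean_state_linear velocity_sq_def residual_sq_state(2)
      by (simp only: mean_state_def state_def fst_conv snd_conv)
  qed
  moreover have "(real k)\<^sup>2 * ?d k \<le> (real (Suc k))\<^sup>2 * ?d k" for k
    using nn by (intro mult_right_mono power_mono) auto
  ultimately have le: "(real k)\<^sup>2 * ?d k \<le> 2 * velocity_sq k + 8 * ((real (Suc k))\<^sup>2 * residual_sq k)" for k
    by (meson order_trans)
  have "(\<lambda>k. 2 * velocity_sq k + 8 * ((real (Suc k))\<^sup>2 * residual_sq k)) \<longlonglongrightarrow> 2 * 0 + 8 * 0"
    by (intro tendsto_add tendsto_mult_left velocity_sq_tendsto_0 scaled_residual_tendsto_0)
  then have lim: "(\<lambda>k. 2 * velocity_sq k + 8 * ((real (Suc k))\<^sup>2 * residual_sq k)) \<longlonglongrightarrow> 0" by simp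
  show ?thesis
  proof (rule tendsto_sandwich[OF _ _ tendsto_const lim])
    show "eventually (\<lambda>k. 0 \<le> (real k)\<^sup>2 * ?d k) sequentially"
      using nn by (intro always_eventually allI) simp
    show "eventually (\<lambda>k. (real k)\<^sup>2 * ?d k \<le> 2 * velocity_sq k + 8 * ((real (Suc k))\<^sup>2 * residual_sq k)) sequentially"
      using le by (intro always_eventually allI)
  qed
qed

text \<open>The upper bounds use \<open>L \<beta> \<le> 1/6\<close> and \<open>b q\<^sup>2 \<ge> 1\<close>. The lower bounds say that the
  constants of the potential fit under those of the statement.\<close>
lemma constant_bounds:
  shows "1280/3 \<le> C2 L b q" "C2 L b q \<le> 2360" "2048/3 \<le> C3 L b q" "C3 L b q \<le> 3353"
proof -
  define t where "t = L\<^sup>2 * \<beta>\<^sup>2"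
  have "L * \<beta> \<le> 1/6" using \<beta>_le L_pos by (simp add: field_simps)
  then have "(L * \<beta>)\<^sup>2 \<le> (1/6)\<^sup>2" using L_pos \<beta>_pos by (intro power_mono) auto
  then have t: "0 \<le> t" "t \<le> 1/36" by (simp_all add: t_def power_mult_distrib power_divide)
  have psi: "0 \<le> psi b q" "psi b q \<le> 64/65"
    using bq_range by (auto simp: psi_def divide_simps)
  have C0: "C0 L b q = 30 + 72 * t"
    by (simp add: C0_def t_def algebra_simps)
  have C0_range: "30 \<le> C0 L b q" "C0 L b q \<le> 32" using t by (auto simp: C0)
  have psiC0: "0 \<le> psi b q * C0 L b q" "psi b q * C0 L b q \<le> 64/65 * 32"
    using psi C0_range mult_mono[OF psi(2) C0_range(2)] by simp_all
  have C1: "C1 L b q = 72/5 * t + 2/3 * C0 L b q + psi b q * C0 L b q"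
    by (simp add: C1_def t_def algebra_simps)
  have C2: "C2 L b q = 36 * t + 50/3 * C0 L b q + psi b q * C0 L b q + 100/3 * C1 L b q"
    by (simp add: C2_def t_def algebra_simps)
  have C1_range: "20 \<le> C1 L b q" "C1 L b q \<le> 5325/100"
    using t C0_range psiC0 unfolding C1 by argo+
  have C2_range: "1166 \<le> C2 L b q" "C2 L b q \<le> 2341"
    using t C0_range psiC0 C1_range unfolding C2 by argo+
  show "1280/3 \<le> C2 L b q" "C2 L b q \<le> 2360" using C2_range by argo+
  show "2048/3 \<le> C3 L b q" "C3 L b q \<le> 3353"
    using C1_range C2_range unfolding C3_def by argo+
qed

lemma increment_rate:
  assumes "xs \<in> zer g"
  shows "expectation (\<lambda>\<omega>. (norm (x (Suc k) \<omega> - x k \<omega>))\<^sup>2) \<le> C2 L b q * (norm (x0 - xs))\<^sup>2 / (real k + 5)\<^sup>2"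
proof -
  have "(real k + 5)\<^sup>2 * expectation (\<lambda>\<omega>. (norm (x (Suc k) \<omega> - x k \<omega>))\<^sup>2) \<le> C2 L b q * (norm (x0 - xs))\<^sup>2"
    using increment_bound[OF assms, of k] mult_right_mono[OF constant_bounds(1), of "(norm (x0 - xs))\<^sup>2"] by simp
  then show ?thesis by (simp add: pos_le_divide_eq mult.commute)
qed

lemma residual_rate:
  assumes "xs \<in> zer g"
  shows "expectation (\<lambda>\<omega>. (norm (g (x k \<omega>)))\<^sup>2)
    \<le> C3 L b q * (norm (x0 - xs))\<^sup>2 / (\<beta>\<^sup>2 * (real k + 2) * (real k + 5))"
proof -
  have e: "residual_sq k = \<beta>\<^sup>2 * expectation (\<lambda>\<omega>. (norm (g (x k \<omega>)))\<^sup>2)"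
    by (simp add: residual_sq_def power_mult_distrib)
  have "\<beta>\<^sup>2 * (real k + 2) * (real k + 5) * expectation (\<lambda>\<omega>. (norm (g (x k \<omega>)))\<^sup>2) \<le> C3 L b q * (norm (x0 - xs))\<^sup>2"
    using residual_bound[OF assms, of k] mult_right_mono[OF constant_bounds(3), of "(norm (x0 - xs))\<^sup>2"]
    unfolding e by (simp add: mult_ac)
  moreover have "\<beta>\<^sup>2 * (real k + 2) * (real k + 5) > 0" using \<beta>_pos by simp
  ultimately show ?thesis by (simp add: pos_le_divide_eq mult.commute)
qed

text \<open>The residual bound yields accuracy \<open>\<epsilon>\<close> after about \<open>L R / \<epsilon>\<close> iterations, and a later
  iteration costs \<open>3 b + q n\<close> evaluations on average, which is of order \<open>n\<close> to the power
  \<open>2/3\<close> for the given parameters.\<close>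
lemma complexity:
  assumes xs: "xs \<in> zer g" and \<epsilon>: "\<epsilon> > 0"
    and q: "q \<le> cq * real n powr (-1/3)" and b: "real b \<le> cb * real n powr (2/3)"
  shows "\<exists>K. expectation (\<lambda>\<omega>. (norm (g (x K \<omega>)))\<^sup>2) \<le> \<epsilon>\<^sup>2 \<and>
     expectation (\<lambda>\<omega>. real (svrg_evals n b Z K \<omega>))
       \<le> (1 + 7540 * (3 * \<bar>cb\<bar> + \<bar>cq\<bar>)) * (real n + real n powr (2/3) * L * norm (x0 - xs) / \<epsilon>)"
proof -
  define R r where "R = norm (x0 - xs)" and "r = L * R / \<epsilon>"
  \<comment> \<open>\<open>7540 = 58 * 130\<close>, where \<open>58\<^sup>2 \<ge> 3353\<close> covers \<open>C3\<close> and \<open>130\<close> comes from \<open>1 / (130 L) \<le> \<beta>\<close>.\<close>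
  define K where "K = nat \<lceil>7540 * r\<rceil>"
  have r: "r \<ge> 0" using L_pos \<epsilon> by (simp add: r_def R_def)
  have K: "7540 * r \<le> real K" by (simp add: K_def real_nat_ceiling_ge)
  have "(1 / (130 * L))\<^sup>2 \<le> \<beta>\<^sup>2" using \<beta>_ge L_pos by (intro power_mono) auto
  then have \<beta>2: "1 \<le> 16900 * L\<^sup>2 * \<beta>\<^sup>2" using L_pos by (simp add: power_divide power_mult_distrib field_simps)
  have "C3 L b q * R\<^sup>2 \<le> \<epsilon>\<^sup>2 * (\<beta>\<^sup>2 * (real K + 2) * (real K + 5))"
  proof -
    have "C3 L b q * R\<^sup>2 \<le> 3364 * R\<^sup>2"
      using constant_bounds(4) by (intro mult_right_mono) auto
    also have "\<dots> \<le> 3364 * R\<^sup>2 * (16900 * L\<^sup>2 * \<beta>\<^sup>2)"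
      using mult_left_mono[OF \<beta>2, of "3364 * R\<^sup>2"] by simp
    also have "\<dots> = (\<epsilon> * \<beta>)\<^sup>2 * (7540 * r)\<^sup>2"
      using \<epsilon> by (simp add: r_def power_mult_distrib power_divide)
    also have "\<dots> \<le> (\<epsilon> * \<beta>)\<^sup>2 * (real K)\<^sup>2"
      using K r by (intro mult_left_mono power_mono) auto
    also have "\<dots> \<le> (\<epsilon> * \<beta>)\<^sup>2 * ((real K + 2) * (real K + 5))"
    proof (rule mult_left_mono)
      show "(real K)\<^sup>2 \<le> (real K + 2) * (real K + 5)"
        by (simp add: power2_eq_square algebra_simps)
    qed simp
    finally show ?thesis by (simp add: power_mult_distrib mult_ac)
  qed
  then have "C3 L b q * R\<^sup>2 / (\<beta>\<^sup>2 * (real K + 2) * (real K + 5)) \<le> \<epsilon>\<^sup>2"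
    using \<beta>_pos by (subst pos_divide_le_eq) auto
  then have accuracy: "expectation (\<lambda>\<omega>. (norm (g (x K \<omega>)))\<^sup>2) \<le> \<epsilon>\<^sup>2"
    using residual_rate[OF xs, of K] by (simp add: R_def)
  define N where "N = real n powr (2/3)"
  define c where "c = 3 * \<bar>cb\<bar> + \<bar>cq\<bar>"
  have N: "N \<ge> 0" and c: "c \<ge> 0" by (auto simp: N_def c_def)
  have "expectation (\<lambda>\<omega>. real (svrg_evals n b Z K \<omega>)) \<le> real n + 7540 * r * (c * N)"
  proof (cases K)
    case 0
    then show ?thesis using r c N by (simp add: svrg_evals_def)
  next
    case (Suc J)
    have J: "real J \<le> 7540 * r"
      using Suc r unfolding K_def by linarith
    have "real n * real n powr (-1/3) = N"
      using n_pos powr_add[of "real n" 1 "-1/3"] by (simp add: N_def)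
    then have "q * real n \<le> cq * N"
      using mult_right_mono[OF q, of "real n"] by (simp add: mult_ac)
    moreover have "cq * N \<le> \<bar>cq\<bar> * N" "cb * N \<le> \<bar>cb\<bar> * N"
      using N by (auto intro: mult_right_mono)
    ultimately have cost: "3 * real b + q * real n \<le> c * N"
      using b unfolding c_def N_def[symmetric] by (simp add: distrib_right)
    have "real J * (3 * real b + q * real n) \<le> 7540 * r * (c * N)"
      using J cost q_range r by (intro mult_mono) auto
    then show ?thesis
      unfolding Suc expectation_svrg_evals by simp
  qed
  also have "\<dots> \<le> (1 + 7540 * c) * (real n + N * r)"
    using r c N by (simp add: algebra_simps)
  also have "N * r = N * L * R / \<epsilon>" by (simp add: r_def)
  finally show ?thesis
    using accuracy unfolding N_def c_def R_def by blast
qed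

end

theorem corollary1:
  shows "(\<forall>(M :: 'w measure) n (G :: nat \<Rightarrow> real^'p \<Rightarrow> real^'p) L b q x0 Z B w S x.
            vfkm_svrg M n G L b q x0 Z B w S x \<longrightarrow>
              beta L b q \<in> {1 / (130 * L) .. 1 / (6 * L)} \<and>
              C2 L b q \<le> 2360 \<and> C3 L b q \<le> 3353 \<and>
              (\<forall>xs \<in> zer (finite_avg n G).
                (\<forall>k. (\<integral>\<omega>. (norm (x (k + 1) \<omega> - x k \<omega>))\<^sup>2 \<partial>M)
                       \<le> C2 L b q * (norm (x0 - xs))\<^sup>2 / (real k + 5)\<^sup>2) \<and>
                (\<lambda>k. (real k)\<^sup>2 * (\<integral>\<omega>. (norm (x (k + 1) \<omega> - x k \<omega>))\<^sup>2 \<partial>M)) \<longlonglongrightarrow> 0 \<and>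
                (\<forall>k. (\<integral>\<omega>. (norm (finite_avg n G (x k \<omega>)))\<^sup>2 \<partial>M)
                       \<le> C3 L b q * (norm (x0 - xs))\<^sup>2
                          / ((beta L b q)\<^sup>2 * (real k + 2) * (real k + 5))) \<and>
                (\<lambda>k. (real k)\<^sup>2 * (\<integral>\<omega>. (norm (finite_avg n G (x k \<omega>)))\<^sup>2 \<partial>M)) \<longlonglongrightarrow> 0))
         \<and>
         (\<forall>cq cb :: real. \<exists>C > 0.
            \<forall>(M :: 'w measure) n (G :: nat \<Rightarrow> real^'p \<Rightarrow> real^'p) L b q x0 Z B w S x.
              vfkm_svrg M n G L b q x0 Z B w S x \<longrightarrow>
              q \<le> cq * real n powr (-1/3) \<longrightarrow>
              real b \<le> cb * real n powr (2/3) \<longrightarrow>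
              (\<forall>xs \<in> zer (finite_avg n G). \<forall>\<epsilon> > 0. \<exists>K.
                 (\<integral>\<omega>. (norm (finite_avg n G (x K \<omega>)))\<^sup>2 \<partial>M) \<le> \<epsilon>\<^sup>2 \<and>
                 (\<integral>\<omega>. real (svrg_evals n b Z K \<omega>) \<partial>M)
                   \<le> C * (real n + real n powr (2/3) * L * norm (x0 - xs) / \<epsilon>)))"
proof (intro conjI allI impI ballI)
  fix M :: "'w measure" and n b :: nat and G :: "nat \<Rightarrow> real^'p \<Rightarrow> real^'p" and L q x0 Z B w S x xs
  assume "vfkm_svrg M n G L b q x0 Z B w S x"
  then interpret vfkm_svrg M n G L b q x0 Z B w S x .
  show "beta L b q \<in> {1 / (130 * L) .. 1 / (6 * L)}" using \<beta>_ge \<beta>_le by simp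
  show "C2 L b q \<le> 2360" "C3 L b q \<le> 3353" by (rule constant_bounds)+
  show "(\<lambda>k. (real k)\<^sup>2 * (\<integral>\<omega>. (norm (finite_avg n G (x k \<omega>)))\<^sup>2 \<partial>M)) \<longlonglongrightarrow> 0"
    by (rule residual_limit)
  show "(\<lambda>k. (real k)\<^sup>2 * (\<integral>\<omega>. (norm (x (k + 1) \<omega> - x k \<omega>))\<^sup>2 \<partial>M)) \<longlonglongrightarrow> 0"
    using increment_limit by simp
  assume xs: "xs \<in> zer (finite_avg n G)"
  fix k
  show "(\<integral>\<omega>. (norm (x (k + 1) \<omega> - x k \<omega>))\<^sup>2 \<partial>M) \<le> C2 L b q * (norm (x0 - xs))\<^sup>2 / (real k + 5)\<^sup>2"
    using increment_rate[OF xs, of k] by simp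
  show "(\<integral>\<omega>. (norm (finite_avg n G (x k \<omega>)))\<^sup>2 \<partial>M)
     \<le> C3 L b q * (norm (x0 - xs))\<^sup>2 / ((beta L b q)\<^sup>2 * (real k + 2) * (real k + 5))"
    by (rule residual_rate[OF xs])
next
  fix cq cb :: real
  let ?C = "1 + 7540 * (3 * \<bar>cb\<bar> + \<bar>cq\<bar>)"
  show "\<exists>C > 0.
            \<forall>(M :: 'w measure) n (G :: nat \<Rightarrow> real^'p \<Rightarrow> real^'p) L b q x0 Z B w S x.
              vfkm_svrg M n G L b q x0 Z B w S x \<longrightarrow>
              q \<le> cq * real n powr (-1/3) \<longrightarrow>
              real b \<le> cb * real n powr (2/3) \<longrightarrow>
              (\<forall>xs \<in> zer (finite_avg n G). \<forall>\<epsilon> > 0. \<exists>K.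
                 (\<integral>\<omega>. (norm (finite_avg n G (x K \<omega>)))\<^sup>2 \<partial>M) \<le> \<epsilon>\<^sup>2 \<and>
                 (\<integral>\<omega>. real (svrg_evals n b Z K \<omega>) \<partial>M)
                   \<le> C * (real n + real n powr (2/3) * L * norm (x0 - xs) / \<epsilon>))"
  proof (intro exI[of _ ?C] conjI allI impI ballI)
    show "?C > 0" by (simp add: add_pos_nonneg)
  qed (rule vfkm_svrg.complexity)
qed

end
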